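(* Let $Y$ be a $2$-dimensional systolic complex. Then $Y$ satisfies Property A, i.e. the $1$-skeleton graph $Y^1$ (with its shortest path metric on the vertex set $Y^0$) satisfies Property A.
   Context: All graphs are simplicial (no loops, no multiple edges). Metrics are considered only on the $0$-skeleton of a complex, and are induced by the shortest path metric $d$ of the $1$-skeleton. The girth of a graph is the length of a shortest embedded cycle (infinite if there is none). The link of a vertex $v$ in a $2$-dimensional simplicial complex is the graph whose vertices are the neighbours of $v$, two of them being joined by an edge if they span a triangle together with $v$. A $2$-dimensional systolic complex is a simply connected $2$-dimensional simplicial complex in which the girth of the link of every vertex is at least $6$. No local finiteness is assumed. Property A for a graph $\Gamma$ is the following condition: there exist a sequence of constants $(C_n)_{n\in\mathbb{N}}$ and a family of functions $f_{n,v}\colon \Gamma^0\to\mathbb{N}$ (where $0 \in \mathbb{N}$) indexed by $(n,v)\in\mathbb{N}\times\Gamma^0$, with $0<\|f_{n,v}\|_1<\infty$, such that (1) $f_{n,v}$ is supported on the ball $B_{C_n}(v)=\{w\in\Gamma^0 : d(v,w)\le C_n\}$; and (2) $\frac{\|f_{n,v}-f_{n,v'}\|_1}{\|f_{n,v}\|_1}\to 0$ as $n\to\infty$, uniformly over all pairs of vertices $(v,v')$ joined by an edge. A complex satisfies Property A if its $1$-skeleton does. *)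

theory Defs
  imports "HOL-Analysis.Analysis"
begin

section \<open>Graphs\<close>

text \<open>A graph is a pair of a vertex set and a set of two-element sets of vertices;
  neither set is assumed finite.\<close>

type_synonym 'a graph = "'a set \<times> 'a set set"

abbreviation verts :: "'a graph \<Rightarrow> 'a set" where
  "verts G \<equiv> fst G"

abbreviation edges :: "'a graph \<Rightarrow> 'a set set" where
  "edges G \<equiv> snd G"

definition simple_graph :: "'a graph \<Rightarrow> bool" where
  "simple_graph G \<longleftrightarrow> (\<forall>e\<in>edges G. e \<subseteq> verts G \<and> card e = 2)"

definition walk :: "'a graph \<Rightarrow> 'a list \<Rightarrow> bool" where
  "walk G p \<longleftrightarrow> p \<noteq> [] \<and> set p \<subseteq> verts G \<and>
     (\<forall>i. Suc i < length p \<longrightarrow> {p ! i, p ! Suc i} \<in> edges G)"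

text \<open>The value is \<open>\<infinity>\<close> when the two vertices are not joined by a walk.\<close>

definition graph_dist :: "'a graph \<Rightarrow> 'a \<Rightarrow> 'a \<Rightarrow> enat" where
  "graph_dist G u v =
     (INF p\<in>{p. walk G p \<and> hd p = u \<and> last p = v}. enat (length p - 1))"

text \<open>An embedded cycle is listed without repeating its starting vertex, so that the length
  of the list is the length of the cycle.\<close>

definition embedded_cycle :: "'a graph \<Rightarrow> 'a list \<Rightarrow> bool" where
  "embedded_cycle G c \<longleftrightarrow>
     walk G c \<and> distinct c \<and> 3 \<le> length c \<and> {last c, hd c} \<in> edges G"

definition girth :: "'a graph \<Rightarrow> enat" where
  "girth G = (INF c\<in>{c. embedded_cycle G c}. enat (length c))"


section \<open>Property A\<close>

definition l1_norm_on :: "'a set \<Rightarrow> ('a \<Rightarrow> real) \<Rightarrow> real" where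
  "l1_norm_on V g = (\<Sum>\<^sub>\<infinity>w\<in>V. \<bar>g w\<bar>)"

text \<open>The condition \<open>\<parallel>f\<^sub>n\<^sub>,\<^sub>v\<parallel>\<^sub>1 < \<infinity>\<close> is the summability requirement; without it the infinite sum
  would be \<open>0\<close> by convention.\<close>

definition property_A :: "'a graph \<Rightarrow> bool" where
  "property_A G \<longleftrightarrow>
     (\<exists>(C :: nat \<Rightarrow> nat) (f :: nat \<Rightarrow> 'a \<Rightarrow> 'a \<Rightarrow> nat).
        (\<forall>n. \<forall>v\<in>verts G.
           (\<lambda>w. \<bar>real (f n v w)\<bar>) summable_on verts G \<and>
           0 < l1_norm_on (verts G) (\<lambda>w. real (f n v w)) \<and>
           (\<forall>w\<in>verts G. f n v w \<noteq> 0 \<longrightarrow> graph_dist G v w \<le> enat (C n))) \<and>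
        uniform_limit {(v, v'). {v, v'} \<in> edges G}
          (\<lambda>n (v, v'). l1_norm_on (verts G) (\<lambda>w. real (f n v w) - real (f n v' w)) /
                        l1_norm_on (verts G) (\<lambda>w. real (f n v w)))
          (\<lambda>_. 0) sequentially)"


section \<open>Simplicial complexes and their geometric realisation\<close>

text \<open>A complex is given by its set of nonempty simplices, each identified with its finite set
  of vertices.\<close>

definition abstract_complex :: "'a set set \<Rightarrow> bool" where
  "abstract_complex K \<longleftrightarrow>
     (\<forall>\<sigma>\<in>K. finite \<sigma> \<and> \<sigma> \<noteq> {}) \<and> (\<forall>\<sigma>\<in>K. \<forall>\<tau>. \<tau> \<subseteq> \<sigma> \<and> \<tau> \<noteq> {} \<longrightarrow> \<tau> \<in> K)"

definition one_skeleton :: "'a set set \<Rightarrow> 'a graph" where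
  "one_skeleton K = (\<Union>K, {e \<in> K. card e = 2})"

definition link_graph :: "'a set set \<Rightarrow> 'a \<Rightarrow> 'a graph" where
  "link_graph K v =
     ({w. w \<noteq> v \<and> {v, w} \<in> K}, {e. card e = 2 \<and> v \<notin> e \<and> insert v e \<in> K})"

text \<open>Points of the realisation are given by barycentric coordinates.\<close>

definition geometric_simplex :: "'a set \<Rightarrow> ('a \<Rightarrow> real) set" where
  "geometric_simplex \<sigma> =
     {x. (\<forall>v. 0 \<le> x v) \<and> (\<forall>v. v \<notin> \<sigma> \<longrightarrow> x v = 0) \<and> sum x \<sigma> = 1}"

text \<open>The weak (CW) topology: each closed simplex carries its Euclidean topology, which is the
  one induced from the product topology on functions since simplices are finite, and a set is
  open iff it meets every closed simplex in a relatively open set.\<close>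

definition realisation :: "'a set set \<Rightarrow> ('a \<Rightarrow> real) topology" where
  "realisation K = topology (\<lambda>U. U \<subseteq> (\<Union>\<sigma>\<in>K. geometric_simplex \<sigma>) \<and>
     (\<forall>\<sigma>\<in>K. openin (top_of_set (geometric_simplex \<sigma>)) (U \<inter> geometric_simplex \<sigma>)))"

lemma openin_realisation:
  "openin (realisation K) U \<longleftrightarrow> U \<subseteq> (\<Union>\<sigma>\<in>K. geometric_simplex \<sigma>) \<and>
     (\<forall>\<sigma>\<in>K. openin (top_of_set (geometric_simplex \<sigma>)) (U \<inter> geometric_simplex \<sigma>))"
proof -
  let ?L = "\<lambda>U. U \<subseteq> (\<Union>\<sigma>\<in>K. geometric_simplex \<sigma>) \<and>
     (\<forall>\<sigma>\<in>K. openin (top_of_set (geometric_simplex \<sigma>)) (U \<inter> geometric_simplex \<sigma>))"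
  have "istopology ?L"
    unfolding istopology_def
  proof (intro conjI allI impI)
    fix S T assume S: "?L S" and T: "?L T"
    show "S \<inter> T \<subseteq> (\<Union>\<sigma>\<in>K. geometric_simplex \<sigma>)" using S by blast
    show "\<forall>\<sigma>\<in>K. openin (top_of_set (geometric_simplex \<sigma>)) (S \<inter> T \<inter> geometric_simplex \<sigma>)"
    proof
      fix \<sigma> assume "\<sigma> \<in> K"
      then have "openin (top_of_set (geometric_simplex \<sigma>))
          ((S \<inter> geometric_simplex \<sigma>) \<inter> (T \<inter> geometric_simplex \<sigma>))"
        using S T by (intro openin_Int[where S="S \<inter> geometric_simplex \<sigma>" and T="T \<inter> geometric_simplex \<sigma>"]) blast+
      moreover have "(S \<inter> geometric_simplex \<sigma>) \<inter> (T \<inter> geometric_simplex \<sigma>)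
          = S \<inter> T \<inter> geometric_simplex \<sigma>" by blast
      ultimately show "openin (top_of_set (geometric_simplex \<sigma>)) (S \<inter> T \<inter> geometric_simplex \<sigma>)"
        by simp
    qed
  next
    fix \<K> assume H: "\<forall>S\<in>\<K>. ?L S"
    show "\<Union>\<K> \<subseteq> (\<Union>\<sigma>\<in>K. geometric_simplex \<sigma>)" using H by blast
    show "\<forall>\<sigma>\<in>K. openin (top_of_set (geometric_simplex \<sigma>)) (\<Union>\<K> \<inter> geometric_simplex \<sigma>)"
    proof
      fix \<sigma> assume "\<sigma> \<in> K"
      then have "openin (top_of_set (geometric_simplex \<sigma>))
          (\<Union>((\<lambda>S. S \<inter> geometric_simplex \<sigma>) ` \<K>))"
        using H by (intro openin_Union) auto
      moreover have "\<Union>((\<lambda>S. S \<inter> geometric_simplex \<sigma>) ` \<K>) = \<Union>\<K> \<inter> geometric_simplex \<sigma>"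
        by blast
      ultimately show "openin (top_of_set (geometric_simplex \<sigma>)) (\<Union>\<K> \<inter> geometric_simplex \<sigma>)"
        by simp
    qed
  qed
  then show ?thesis
    unfolding realisation_def by (simp add: topology_inverse')
qed

lemma topspace_realisation:
  "topspace (realisation K) = (\<Union>\<sigma>\<in>K. geometric_simplex \<sigma>)"
proof
  show "topspace (realisation K) \<subseteq> (\<Union>\<sigma>\<in>K. geometric_simplex \<sigma>)"
    using openin_realisation[of K "topspace (realisation K)"] by simp
  have "openin (realisation K) (\<Union>\<sigma>\<in>K. geometric_simplex \<sigma>)"
    unfolding openin_realisation
  proof (intro conjI ballI)
    fix \<sigma> assume "\<sigma> \<in> K"
    then have "(\<Union>\<sigma>\<in>K. geometric_simplex \<sigma>) \<inter> geometric_simplex \<sigma> = geometric_simplex \<sigma>"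
      by blast
    then show "openin (top_of_set (geometric_simplex \<sigma>))
        ((\<Union>\<sigma>\<in>K. geometric_simplex \<sigma>) \<inter> geometric_simplex \<sigma>)"
      by simp
  qed simp
  then show "(\<Union>\<sigma>\<in>K. geometric_simplex \<sigma>) \<subseteq> topspace (realisation K)"
    by (rule openin_subset)
qed


section \<open>Two-dimensional systolic complexes\<close>

text \<open>Loops are contracted by homotopies fixing their base point. The library's
  \<^const>\<open>simply_connected\<close> is only about subsets of normed vector spaces.\<close>

definition simply_connected_top :: "'b topology \<Rightarrow> bool" where
  "simply_connected_top X \<longleftrightarrow>
     path_connected_space X \<and>
     (\<forall>p. pathin X p \<and> p 1 = p 0 \<longrightarrow>
        homotopic_with (\<lambda>q. q 0 = p 0 \<and> q 1 = p 0) (top_of_set {0..1}) X p (\<lambda>_. p 0))"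

text \<open>Two-dimensional means of dimension at most \<open>2\<close>, so trees are included.\<close>

definition systolic_2_complex :: "'a set set \<Rightarrow> bool" where
  "systolic_2_complex K \<longleftrightarrow>
     abstract_complex K \<and> (\<forall>\<sigma>\<in>K. card \<sigma> \<le> 3) \<and>
     simply_connected_top (realisation K) \<and>
     (\<forall>v\<in>\<Union>K. girth (link_graph K v) \<ge> 6)"

lemma simple_graph_one_skeleton: "simple_graph (one_skeleton K)"
  by (auto simp: simple_graph_def one_skeleton_def)

lemma simple_graph_link_graph:
  assumes "abstract_complex K"
  shows "simple_graph (link_graph K v)"
  unfolding simple_graph_def link_graph_def fst_conv snd_conv
proof (rule ballI)
  fix e assume "e \<in> {e. card e = 2 \<and> v \<notin> e \<and> insert v e \<in> K}"
  then have e: "card e = 2" "v \<notin> e" "insert v e \<in> K"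
    by simp_all
  have "e \<subseteq> {w. w \<noteq> v \<and> {v, w} \<in> K}"
  proof
    fix w assume "w \<in> e"
    then have "{v, w} \<subseteq> insert v e" by blast
    then have "{v, w} \<in> K" using assms e unfolding abstract_complex_def by blast
    then show "w \<in> {w. w \<noteq> v \<and> {v, w} \<in> K}" using \<open>w \<in> e\<close> e by blast
  qed
  then show "e \<subseteq> {w. w \<noteq> v \<and> {v, w} \<in> K} \<and> card e = 2"
    using e by simp
qed

end

theory Submission
  imports Defs "HOL-Library.FSet"
begin

text \<open>Fix a base vertex and build a candidate for the universal cover level by level: a vertex of level
  \<open>n + 1\<close> is a vertex of \<open>Y\<close> together with its full set of parents in level \<open>n\<close>. Because the links
  contain no cycles of length 3, 4 or 5, there are one or two (adjacent) parents, adjacent vertices of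
  the same level have a common parent, and the projection to \<open>Y\<close> is a bijection on neighbourhoods.
  Simple connectivity (through a simplicial approximation of a homotopy of loops) makes the
  projection bijective, so \<open>Y\<close> itself carries such levels.

  Now let a particle walk downwards, choosing each of the two parents with probability one half.
  Two particles at horizontal distance \<open>m + 1\<close> can be coupled so that their distance becomes at most
  \<open>m\<close> or \<open>m + 2\<close>, each with probability one half; hence they meet almost surely, at a rate that
  depends on \<open>m\<close> only. The functions of Property A are averages over the time of the distributions
  of the walk, scaled to have integral values.\<close>

section \<open>Development of a complex with wide links\<close>

text \<open>The levels are constructed instead of being defined by the distance to the base vertex.
  In this way statements about parents become statements about links, settled level by level without
  filling diagrams, and simple connectivity is needed only to identify the development with
  \<open>Y\<close>. Uniqueness of the second parent uses the bound 6 in full: two candidates would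
  close up a cycle of length 4 or 5 in a link. The coupling compares vertices of the same level at
  equal times. Along an edge between two levels the walk from the upper end runs one step late, and
  averaging over the times 0 to \<open>n\<close> makes this shift cost only a fraction of order
  1/\<open>n\<close>.\<close>

lemma abstract_complex_face:
  assumes K: "abstract_complex K" and \<tau>: "\<sigma> \<in> K" "\<tau> \<subseteq> \<sigma>" "\<tau> \<noteq> {}"
  shows "\<tau> \<in> K"
proof -
  have "\<forall>\<sigma>\<in>K. \<forall>\<tau>. \<tau> \<subseteq> \<sigma> \<and> \<tau> \<noteq> {} \<longrightarrow> \<tau> \<in> K"
    using K unfolding abstract_complex_def by (rule conjunct2)
  from bspec[OF this \<tau>(1)] show ?thesis using \<tau>(2,3) by simp
qed

text \<open>With the set of parents as part of a vertex, the children of two adjacent vertices are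
  identified by plain equality.\<close>

datatype 'a dev = Dev (lab: 'a) (parents: "'a dev fset")

locale wide_links =
  fixes Y :: "'a set set" and o\<^sub>Y :: 'a
  assumes complex: "abstract_complex Y"
    and base: "{o\<^sub>Y} \<in> Y"
    and wide: "\<And>v. v \<in> \<Union>Y \<Longrightarrow> 6 \<le> girth (link_graph Y v)"
begin

lemmas face = abstract_complex_face[OF complex]

section \<open>Links without short cycles\<close>

definition lk :: "'a \<Rightarrow> 'a \<Rightarrow> 'a \<Rightarrow> bool" where
  "lk v a b \<longleftrightarrow> {v, a, b} \<in> Y \<and> a \<noteq> b \<and> a \<noteq> v \<and> b \<noteq> v"

lemma lk_sym: "lk v a b \<Longrightarrow> lk v b a"
  by (auto simp: lk_def insert_commute)

lemma lk_rot: "lk v a b \<Longrightarrow> lk a v b"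
  by (auto simp: lk_def insert_commute)

lemma lk_edge: "lk v a b \<Longrightarrow> {v, a} \<in> Y"
  unfolding lk_def by (auto intro: face)

lemma link_edge_iff: "{a, b} \<in> edges (link_graph Y v) \<longleftrightarrow> lk v a b"
  by (auto simp: link_graph_def lk_def card_2_iff doubleton_eq_iff insert_commute)

lemma link_vert: "lk v a b \<Longrightarrow> a \<in> verts (link_graph Y v)"
  using lk_edge by (auto simp: link_graph_def lk_def)

lemma no_short_cycle:
  assumes "embedded_cycle (link_graph Y v) c"
  shows "6 \<le> length c"
proof -
  have "girth (link_graph Y v) \<le> enat (length c)"
    unfolding girth_def by (rule INF_lower) (use assms in simp)
  moreover have "v \<in> \<Union>Y"
  proof -
    have "hd c \<in> verts (link_graph Y v)"
      using assms unfolding embedded_cycle_def walk_def by (meson hd_in_set subsetD)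
    then show ?thesis by (auto simp: link_graph_def)
  qed
  ultimately have "6 \<le> enat (length c)" using wide order_trans by blast
  then show ?thesis by (simp add: numeral_eq_enat)
qed

lemma no_triangle: "\<lbrakk>lk v a b; lk v b c; lk v c a\<rbrakk> \<Longrightarrow> False"
proof -
  assume H: "lk v a b" "lk v b c" "lk v c a"
  have "embedded_cycle (link_graph Y v) [a, b, c]"
    using H link_vert[OF H(1)] link_vert[OF H(2)] link_vert[OF H(3)]
    unfolding embedded_cycle_def walk_def
    by (auto simp: link_edge_iff less_Suc_eq lk_def nth_Cons')
  from no_short_cycle[OF this] show False by simp
qed

lemma no_square: "\<lbrakk>lk v a b; lk v b c; lk v c d; lk v d a; a \<noteq> c; b \<noteq> d\<rbrakk> \<Longrightarrow> False"
proof -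
  assume H: "lk v a b" "lk v b c" "lk v c d" "lk v d a" "a \<noteq> c" "b \<noteq> d"
  have "embedded_cycle (link_graph Y v) [a, b, c, d]"
    using H link_vert[OF H(1)] link_vert[OF H(2)] link_vert[OF H(3)] link_vert[OF H(4)]
    unfolding embedded_cycle_def walk_def
    by (auto simp: link_edge_iff less_Suc_eq lk_def nth_Cons')
  from no_short_cycle[OF this] show False by simp
qed

text \<open>No distinctness is assumed, because a repetition in a closed 5-walk would leave a closed
  3-walk. A closed 4-walk may instead backtrack, which explains the two inequalities in
  \<open>no_square\<close>.\<close>

lemma no_pentagon: "\<lbrakk>lk v a b; lk v b c; lk v c d; lk v d e; lk v e a\<rbrakk> \<Longrightarrow> False"
proof -
  assume H: "lk v a b" "lk v b c" "lk v c d" "lk v d e" "lk v e a"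
  have ne: "a \<noteq> c" "b \<noteq> d" "c \<noteq> e" "d \<noteq> a" "e \<noteq> b"
    using H no_triangle by metis+
  have "embedded_cycle (link_graph Y v) [a, b, c, d, e]"
    using H ne link_vert[OF H(1)] link_vert[OF H(2)] link_vert[OF H(3)] link_vert[OF H(4)] link_vert[OF H(5)]
    unfolding embedded_cycle_def walk_def
    by (auto simp: link_edge_iff less_Suc_eq lk_def nth_Cons')
  from no_short_cycle[OF this] show False by simp
qed

section \<open>Levels of the development\<close>

text \<open>Horizontal adjacency. Building the common parent into the relation loses no edges:
  \<open>dev_adj_exists\<close> and \<open>dev_adj_triangle\<close> show that neighbourhoods are
  complete nevertheless.\<close>

definition adj :: "'a dev \<Rightarrow> 'a dev \<Rightarrow> bool" where
  "adj p q \<longleftrightarrow> (\<exists>w. w |\<in>| parents p \<and> w |\<in>| parents q \<and> lk (lab w) (lab p) (lab q))"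

text \<open>These are the edges at \<open>lab p\<close> not yet lifted to an edge going down or
  sideways; each of them has to lead to a new vertex of the next level.\<close>

definition fresh :: "'a dev set \<Rightarrow> 'a dev \<Rightarrow> 'a \<Rightarrow> bool" where
  "fresh S p x \<longleftrightarrow> {lab p, x} \<in> Y \<and> x \<noteq> lab p \<and> (\<forall>w. w |\<in>| parents p \<longrightarrow> x \<noteq> lab w) \<and>
     (\<forall>q\<in>S. adj p q \<longrightarrow> x \<noteq> lab q)"

text \<open>For the triangle over \<open>x\<close>, \<open>lab p\<close>, \<open>lab q\<close> to
  lift, the children of \<open>p\<close> and \<open>q\<close> over \<open>x\<close> must be the same
  vertex, so \<open>q\<close> has to be a parent of it as well.\<close>

definition coparents :: "'a dev set \<Rightarrow> 'a dev \<Rightarrow> 'a \<Rightarrow> 'a dev set" where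
  "coparents S p x = {q \<in> S. adj p q \<and> lk x (lab p) (lab q)}"

text \<open>The parent set must be the right one as seen from each of its members; therefore a child
  is determined by its label and any single parent (\<open>child_unique\<close>).\<close>

primrec level :: "nat \<Rightarrow> 'a dev set" where
  "level 0 = {Dev o\<^sub>Y {||}}"
| "level (Suc n) = {c. parents c \<noteq> {||} \<and> (\<forall>p. p |\<in>| parents c \<longrightarrow> p \<in> level n \<and>
      fresh (level n) p (lab c) \<and> fset (parents c) = insert p (coparents (level n) p (lab c)))}"

lemma adj_sym: "adj p q \<Longrightarrow> adj q p"
  unfolding adj_def using lk_sym by blast

lemma level_SucD:
  assumes "c \<in> level (Suc n)" "p |\<in>| parents c"
  shows "p \<in> level n" "fresh (level n) p (lab c)"
    "fset (parents c) = insert p (coparents (level n) p (lab c))"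
  using assms by auto

lemma level_Suc_parent: "c \<in> level (Suc n) \<Longrightarrow> \<exists>p. p |\<in>| parents c"
  by auto

lemma level_unique: "s \<in> level n \<Longrightarrow> s \<in> level m \<Longrightarrow> n = m"
proof (induction n arbitrary: s m)
  case 0 then show ?case by (cases m) auto
next
  case (Suc n)
  then obtain p where p: "p |\<in>| parents s" using level_Suc_parent by blast
  show ?case
  proof (cases m)
    case 0 then show ?thesis using Suc.prems p by simp
  next
    case (Suc k)
    then show ?thesis using Suc.prems Suc.IH[of p k] p level_SucD(1) by blast
  qed
qed

lemma parent_level:
  assumes "s \<in> level n" "p |\<in>| parents s"
  shows "\<exists>k. n = Suc k \<and> p \<in> level k"
  using assms by (cases n) auto

lemma child_unique:
  assumes "c \<in> level (Suc n)" "c' \<in> level (Suc n)" "p |\<in>| parents c" "p |\<in>| parents c'" "lab c = lab c'"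
  shows "c = c'"
proof -
  have "fset (parents c) = fset (parents c')"
    using level_SucD(3)[OF assms(1,3)] level_SucD(3)[OF assms(2,4)] assms(5) by simp
  then show ?thesis using assms(5) by (simp add: dev.expand fset_inject)
qed

lemma parents_adj:
  assumes "c \<in> level (Suc n)" "p |\<in>| parents c" "q |\<in>| parents c" "p \<noteq> q"
  shows "adj p q" "lk (lab c) (lab p) (lab q)"
proof -
  have "q \<in> coparents (level n) p (lab c)"
    using level_SucD(3)[OF assms(1,2)] assms(3,4) by auto
  then show "adj p q" "lk (lab c) (lab p) (lab q)" unfolding coparents_def by auto
qed

lemma parent_edge:
  assumes "c \<in> level (Suc n)" "p |\<in>| parents c"
  shows "{lab p, lab c} \<in> Y" "lab p \<noteq> lab c"
  using level_SucD(2)[OF assms] unfolding fresh_def by auto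

text \<open>A parent \<open>w\<close> other than the common parent \<open>w1\<close> is a horizontal
  neighbour of \<open>w1\<close>, and the label of the child \<open>t\<close> of \<open>w1\<close>
  avoids such neighbours by freshness.\<close>

lemma adj_parent_label:
  assumes "s \<in> level n" "t \<in> level n" "adj s t" "w |\<in>| parents s"
  shows "lab t \<noteq> lab w"
proof -
  obtain k where n: "n = Suc k" using parent_level assms by blast
  obtain w1 where w1: "w1 |\<in>| parents s" "w1 |\<in>| parents t" "lk (lab w1) (lab s) (lab t)"
    using assms(3) adj_def by blast
  have f: "fresh (level k) w1 (lab t)" using level_SucD(2) assms(2) n w1(2) by blast
  show ?thesis
  proof (cases "w = w1")
    case True then show ?thesis using w1 lk_def by auto
  next
    case False
    then have "adj w1 w" using parents_adj assms(1,4) n w1(1) by metis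
    then show ?thesis using f level_SucD(1) assms(1,4) n unfolding fresh_def by blast
  qed
qed

text \<open>If the two common parents with \<open>s\<close> agree, \<open>child_unique\<close>
  applies; otherwise they form a triangle with the shared label in the link of
  \<open>s\<close>.\<close>

lemma adj_label_inj:
  assumes "s \<in> level n" "t \<in> level n" "t' \<in> level n" "adj s t" "adj s t'" "lab t = lab t'"
  shows "t = t'"
proof -
  obtain w where w: "w |\<in>| parents s" "w |\<in>| parents t" "lk (lab w) (lab s) (lab t)"
    using assms(4) adj_def by blast
  obtain w' where w': "w' |\<in>| parents s" "w' |\<in>| parents t'" "lk (lab w') (lab s) (lab t')"
    using assms(5) adj_def by blast
  obtain k where n: "n = Suc k" using parent_level assms(1) w by blast
  show ?thesis
  proof (cases "w = w'")
    case True then show ?thesis using child_unique assms n w w' by metis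
  next
    case False
    then have "lk (lab s) (lab w) (lab w')" using parents_adj assms(1) n w w' by metis
    moreover have "lk (lab s) (lab t) (lab w)" "lk (lab s) (lab w') (lab t)"
      using w w' assms(6) lk_rot lk_sym by metis+
    ultimately show ?thesis using no_triangle by blast
  qed
qed

text \<open>In the link of \<open>s\<close>, the labels of \<open>x\<close>, \<open>q\<close>, a
  common parent of \<open>s\<close> and \<open>q\<close>, a common parent of \<open>s\<close> and
  \<open>q'\<close>, and \<open>q'\<close> form a cycle of length 4 or 5, according to whether the
  two common parents coincide.\<close>

lemma coparents_unique:
  assumes s: "s \<in> level n" and f: "fresh (level n) s x"
    and q: "q \<in> coparents (level n) s x" "q' \<in> coparents (level n) s x"
  shows "q = q'"
proof (rule ccontr)
  assume ne: "q \<noteq> q'"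
  have Q: "q \<in> level n" "q' \<in> level n" "adj s q" "adj s q'" "lk x (lab s) (lab q)" "lk x (lab s) (lab q')"
    using q unfolding coparents_def by auto
  obtain w where w: "w |\<in>| parents s" "w |\<in>| parents q" "lk (lab w) (lab s) (lab q)"
    using Q(3) adj_def by blast
  obtain w' where w': "w' |\<in>| parents s" "w' |\<in>| parents q'" "lk (lab w') (lab s) (lab q')"
    using Q(4) adj_def by blast
  obtain k where n: "n = Suc k" using parent_level s w by blast
  have e: "lk (lab s) x (lab q)" "lk (lab s) (lab q) (lab w)" "lk (lab s) (lab w') (lab q')" "lk (lab s) (lab q') x"
    using Q w w' lk_rot lk_sym by metis+
  have lne: "lab q \<noteq> lab q'" using adj_label_inj s Q ne by blast
  have xw: "x \<noteq> lab w" using f w unfolding fresh_def by blast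
  show False
  proof (cases "w = w'")
    case True then show ?thesis using no_square e lne xw by metis
  next
    case False
    then have "lk (lab s) (lab w) (lab w')" using parents_adj s n w w' by metis
    then show ?thesis using no_pentagon e by blast
  qed
qed

text \<open>The link of \<open>lab q\<close> contains the path \<open>x\<close>,
  \<open>lab s\<close>, \<open>lab w\<close>. If \<open>x\<close> were the label of a parent or of a
  horizontal neighbour of \<open>q\<close>, this path would close up to a triangle or a
  square.\<close>

lemma coparents_fresh:
  assumes s: "s \<in> level n" and f: "fresh (level n) s x" and q: "q \<in> coparents (level n) s x"
  shows "fresh (level n) q x"
proof -
  have Q: "q \<in> level n" "adj s q" "lk x (lab s) (lab q)"
    using q unfolding coparents_def by auto
  obtain w where w: "w |\<in>| parents s" "w |\<in>| parents q" "lk (lab w) (lab s) (lab q)"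
    using Q(2) adj_def by blast
  obtain k where n: "n = Suc k" using parent_level s w by blast
  have e: "lk (lab q) x (lab s)" "lk (lab q) (lab s) (lab w)"
    using Q w lk_rot lk_sym by metis+
  have xw: "x \<noteq> lab w" using f w unfolding fresh_def by blast
  have "x \<noteq> lab w'" if w': "w' |\<in>| parents q" for w'
  proof
    assume x: "x = lab w'"
    then have "lk (lab q) (lab w) (lab w')" using parents_adj Q(1) n w w' xw by metis
    then show False using no_triangle e x by blast
  qed
  moreover have "x \<noteq> lab r" if r: "r \<in> level n" "adj q r" for r
  proof
    assume x: "x = lab r"
    obtain w1 where w1: "w1 |\<in>| parents q" "w1 |\<in>| parents r" "lk (lab w1) (lab q) (lab r)"
      using r(2) adj_def by blast
    have e1: "lk (lab q) (lab w1) x" using w1 x lk_rot lk_sym by metis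
    show False
    proof (cases "w1 = w")
      case True then show ?thesis using no_triangle e e1 by blast
    next
      case False
      then have "lk (lab q) (lab w) (lab w1)" using parents_adj Q(1) n w w1 by metis
      moreover have "lab s \<noteq> lab w1" using adj_parent_label adj_sym Q s w1 by blast
      ultimately show ?thesis using no_square e e1 xw by metis
    qed
  qed
  ultimately show ?thesis using e(1) unfolding fresh_def lk_def
    using lk_edge[OF e(1)] by auto
qed

text \<open>By uniqueness the parent set can only be \<open>{|s|}\<close> or
  \<open>{|s, q|}\<close>. In the second case the defining condition of \<open>level\<close> must
  also hold as seen from \<open>q\<close>, which is the purpose of
  \<open>coparents_fresh\<close>.\<close>

lemma child_exists:
  assumes s: "s \<in> level n" and f: "fresh (level n) s x"
  shows "\<exists>c \<in> level (Suc n). lab c = x \<and> s |\<in>| parents c"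
proof (cases "coparents (level n) s x = {}")
  case True
  then have "Dev x {|s|} \<in> level (Suc n)" using s f by simp
  then show ?thesis by (rule bexI[rotated]) simp
next
  case False
  then obtain q where q: "q \<in> coparents (level n) s x" by blast
  then have s1: "coparents (level n) s x = {q}" using coparents_unique[OF s f] by blast
  have ql: "q \<in> level n" and sq: "s \<in> coparents (level n) q x"
    using q s adj_sym lk_sym unfolding coparents_def by auto
  have fq: "fresh (level n) q x" using coparents_fresh s f q by blast
  have q1: "coparents (level n) q x = {s}" using coparents_unique[OF ql fq] sq by blast
  have "Dev x {|s, q|} \<in> level (Suc n)" using s f ql fq s1 q1 by auto
  then show ?thesis by (rule bexI[rotated]) simp
qed

text \<open>No triangle at \<open>s\<close> has one corner above and one below. If there were one,
  look at \<open>x\<close> from \<open>w\<close>: were \<open>x\<close> fresh there, the child of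
  \<open>w\<close> over \<open>x\<close> would be a horizontal neighbour of \<open>s\<close>; were
  it a horizontal neighbour of \<open>w\<close>, it would be a parent of \<open>s\<close>; were it a
  parent of \<open>w\<close>, the same configuration would occur one level lower.\<close>

lemma fresh_parent_not_linked:
  assumes "s \<in> level n" "fresh (level n) s x" "w |\<in>| parents s"
  shows "\<not> lk (lab s) x (lab w)"
  using assms
proof (induction n arbitrary: s x w)
  case 0 then show ?case by simp
next
  case (Suc n)
  note f = Suc.prems(2)
  have w: "w \<in> level n" "fresh (level n) w (lab s)"
    "fset (parents s) = insert w (coparents (level n) w (lab s))"
    using level_SucD Suc.prems by blast+
  show ?case
  proof
    assume L: "lk (lab s) x (lab w)"
    then have L': "lk (lab w) (lab s) x" "lk (lab s) (lab w) x" using lk_rot lk_sym by metis+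
    have ex: "{lab w, x} \<in> Y" "x \<noteq> lab w" using L' lk_sym lk_edge lk_def by metis+
    show False
    proof (cases "fresh (level n) w x")
      case True
      then obtain c where c: "c \<in> level (Suc n)" "lab c = x" "w |\<in>| parents c"
        using child_exists w by blast
      then have "adj s c" using Suc.prems(3) L' adj_def by blast
      then show ?thesis using f c unfolding fresh_def by blast
    next
      case False
      then consider u where "u |\<in>| parents w" "x = lab u" | q where "q \<in> level n" "adj w q" "x = lab q"
        using ex unfolding fresh_def by blast
      then show ?thesis
      proof cases
        case 1
        then show ?thesis using Suc.IH[OF w(1,2) 1(1)] L' lk_rot by auto
      next
        case 2
        then have "q \<in> fset (parents s)" using w(3) L' unfolding coparents_def by auto
        then show ?thesis using f 2 unfolding fresh_def by auto
      qed
    qed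
  qed
qed

section \<open>The projection is a local isomorphism\<close>

definition dev_adj :: "'a dev \<Rightarrow> 'a dev \<Rightarrow> bool" where
  "dev_adj s t \<longleftrightarrow> (\<exists>n. s \<in> level n \<and> (t \<in> level n \<and> adj s t \<or>
     t |\<in>| parents s \<or> (t \<in> level (Suc n) \<and> s |\<in>| parents t)))"

lemma dev_adj_cases:
  assumes "dev_adj s t" "s \<in> level n"
  obtains (same) "t \<in> level n" "adj s t"
  | (down) k where "n = Suc k" "t \<in> level k" "t |\<in>| parents s"
  | (up) "t \<in> level (Suc n)" "s |\<in>| parents t"
  using assms level_unique parent_level unfolding dev_adj_def by blast

lemma dev_adj_level: "dev_adj s t \<Longrightarrow> s \<in> \<Union>(range level) \<and> t \<in> \<Union>(range level)"
  unfolding dev_adj_def using parent_level by blast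

lemma dev_adj_sym: "dev_adj s t \<Longrightarrow> dev_adj t s"
  unfolding dev_adj_def using adj_sym parent_level by blast

lemma dev_adj_edge:
  assumes "dev_adj s t"
  shows "{lab s, lab t} \<in> Y" "lab t \<noteq> lab s"
proof -
  obtain n where n: "s \<in> level n" using assms dev_adj_def by blast
  from assms n have "{lab s, lab t} \<in> Y \<and> lab t \<noteq> lab s"
  proof (cases rule: dev_adj_cases)
    case same
    then obtain w where "lk (lab w) (lab s) (lab t)" using adj_def by blast
    then show ?thesis using lk_rot lk_sym lk_edge lk_def by metis
  next
    case (down k)
    then show ?thesis using parent_edge n by (metis insert_commute)
  next
    case up
    then show ?thesis using parent_edge by metis
  qed
  then show "{lab s, lab t} \<in> Y" "lab t \<noteq> lab s" by auto
qed

text \<open>Freshness separates the labels of children from all other neighbours, and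
  \<open>adj_parent_label\<close> those of horizontal neighbours from parents. Within each of the
  three types injectivity is known.\<close>

lemma dev_adj_inj:
  assumes "dev_adj s t" "dev_adj s t'" "lab t = lab t'"
  shows "t = t'"
proof -
  obtain n where n: "s \<in> level n" using assms dev_adj_def by blast
  have up_ne: "lab c \<noteq> lab r" if "c \<in> level (Suc n)" "s |\<in>| parents c"
      "(r \<in> level n \<and> adj s r) \<or> r |\<in>| parents s" for c r
    using level_SucD(2)[OF that(1,2)] that(3) unfolding fresh_def by blast
  have par_inj: "r = r'" if "r |\<in>| parents s" "r' |\<in>| parents s" "lab r = lab r'" for r r'
    using that parent_level[OF n] parents_adj n unfolding lk_def by metis
  note ad = adj_parent_label[OF n]
  from assms(1) n show ?thesis
  proof (cases rule: dev_adj_cases)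
    case same
    from assms(2) n show ?thesis
      by (cases rule: dev_adj_cases)
        (use same n assms(3) adj_label_inj ad up_ne in metis)+
  next
    case (down k)
    from assms(2) n show ?thesis
      by (cases rule: dev_adj_cases) (use down assms(3) par_inj ad up_ne in metis)+
  next
    case up
    from assms(2) n show ?thesis
      by (cases rule: dev_adj_cases) (use up n assms(3) child_unique up_ne in metis)+
  qed
qed

lemma dev_adj_exists:
  assumes "s \<in> level n" "{lab s, x} \<in> Y" "x \<noteq> lab s"
  shows "\<exists>t. dev_adj s t \<and> lab t = x"
proof (cases "fresh (level n) s x")
  case True
  then show ?thesis using child_exists assms unfolding dev_adj_def by blast
next
  case False
  then show ?thesis using assms unfolding fresh_def dev_adj_def by blast
qed

text \<open>Case distinction on where the two neighbours lie relative to \<open>s\<close>. Together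
  with the bijection on neighbours this makes the projection a covering of 2-complexes.\<close>

lemma dev_adj_triangle:
  assumes st: "dev_adj s t" "dev_adj s t'" and L: "lk (lab s) (lab t) (lab t')"
  shows "dev_adj t t'"
proof -
  obtain n where n: "s \<in> level n" using st dev_adj_def by blast
  have down_same: "dev_adj r r'" if r: "r |\<in>| parents s" "r' \<in> level n" "adj s r'"
      "lk (lab s) (lab r) (lab r')" for r r'
  proof -
    obtain k where k: "n = Suc k" "r \<in> level k" using parent_level n r by blast
    obtain w where w: "w |\<in>| parents s" "w |\<in>| parents r'" "lk (lab w) (lab s) (lab r')"
      using r adj_def by blast
    have "w = r"
    proof (rule ccontr)
      assume "w \<noteq> r"
      then have "lk (lab s) (lab w) (lab r)" using parents_adj n k w r by metis
      moreover have "lk (lab s) (lab r') (lab w)" using w lk_rot lk_sym by metis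
      ultimately show False using r(4) no_triangle by blast
    qed
    then show ?thesis using k w r unfolding dev_adj_def by blast
  qed
  have up_same: "dev_adj r c" if r: "r \<in> level n" "adj s r" "c \<in> level (Suc n)" "s |\<in>| parents c"
    "lk (lab s) (lab r) (lab c)" for r c
  proof -
    have "lk (lab c) (lab s) (lab r)" using r lk_sym lk_rot by metis
    then have "r \<in> fset (parents c)"
      using level_SucD(3)[OF r(3,4)] r unfolding coparents_def by auto
    then show ?thesis using r unfolding dev_adj_def by auto
  qed
  have up_down: False if r: "r |\<in>| parents s" "c \<in> level (Suc n)" "s |\<in>| parents c"
    "lk (lab s) (lab r) (lab c)" for r c
    using fresh_parent_not_linked[OF n level_SucD(2)[OF r(2,3)] r(1)] r(4) lk_sym by blast
  \<comment> \<open>This configuration cannot occur: with the parents shared with \<open>s\<close>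
    it would close a triangle or a square in the link of \<open>s\<close>.\<close>
  have same_same: "dev_adj r r'" if r: "r \<in> level n" "adj s r" "r' \<in> level n" "adj s r'"
    "lk (lab s) (lab r) (lab r')" for r r'
  proof -
    obtain w where w: "w |\<in>| parents s" "w |\<in>| parents r" "lk (lab w) (lab s) (lab r)"
      using r adj_def by blast
    obtain w' where w': "w' |\<in>| parents s" "w' |\<in>| parents r'" "lk (lab w') (lab s) (lab r')"
      using r adj_def by blast
    have e: "lk (lab s) (lab w) (lab r)" "lk (lab s) (lab r') (lab w')" using w w' lk_rot lk_sym by metis+
    obtain k where k: "n = Suc k" using parent_level n w by blast
    show ?thesis
    proof (cases "w = w'")
      case True
      then show ?thesis using no_triangle e r(5) by blast
    next
      case False
      then have "lk (lab s) (lab w') (lab w)" using parents_adj n k w w' by metis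
      moreover have "lab w \<noteq> lab r'" "lab r \<noteq> lab w'"
        using adj_parent_label n r w w' by metis+
      ultimately show ?thesis using no_square e r(5) by metis
    qed
  qed
  note L' = L lk_sym[OF L]
  from st(1) n show ?thesis
  proof (cases rule: dev_adj_cases)
    case t_same: same
    from st(2) n show ?thesis
    proof (cases rule: dev_adj_cases)
      case same
      then show ?thesis using t_same L by (intro same_same)
    next
      case (down k)
      then show ?thesis using t_same L'(2) down_same dev_adj_sym by blast
    next
      case up
      then show ?thesis using t_same L by (intro up_same)
    qed
  next
    case (down k)
    from st(2) n show ?thesis
    proof (cases rule: dev_adj_cases)
      case same
      then show ?thesis using down L' down_same by blast
    next
      case (down k')
      have "t \<noteq> t'" using L by (auto simp: lk_def)
      then have "adj t t'" using parents_adj(1) n \<open>n = Suc k\<close> down \<open>t |\<in>| parents s\<close> by metis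
      then show ?thesis using down \<open>n = Suc k\<close> \<open>t \<in> level k\<close> unfolding dev_adj_def by blast
    next
      case up
      then show ?thesis using down L' up_down by blast
    qed
  next
    case up
    from st(2) n show ?thesis
    proof (cases rule: dev_adj_cases)
      case same
      then show ?thesis using up L' up_same dev_adj_sym by blast
    next
      case (down k')
      then show ?thesis using up L' up_down by blast
    next
      case t'up: up
      have "adj t t'" using up t'up L unfolding adj_def by blast
      then show ?thesis using up t'up unfolding dev_adj_def by blast
    qed
  qed
qed

text \<open>Staying put at \<open>lab s\<close> allows walks to stutter, as the rows and columns of
  a simplicial grid may do.\<close>

definition step :: "'a dev \<Rightarrow> 'a \<Rightarrow> 'a dev" where
  "step s x = (if x = lab s then s else (THE t. dev_adj s t \<and> lab t = x))"

lemma step_eqI: "dev_adj s t \<Longrightarrow> step s (lab t) = t"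
  unfolding step_def using dev_adj_edge(2) dev_adj_inj by (auto intro!: the_equality)

lemma step_adj:
  assumes "s \<in> \<Union>(range level)" "{lab s, x} \<in> Y" "x \<noteq> lab s"
  shows "dev_adj s (step s x)" "lab (step s x) = x"
  using dev_adj_exists assms step_eqI by (metis UN_E)+

lemma step_level:
  assumes "s \<in> \<Union>(range level)" "{lab s, x} \<in> Y"
  shows "step s x \<in> \<Union>(range level)" "lab (step s x) = x"
proof -
  have "step s x \<in> \<Union>(range level) \<and> lab (step s x) = x"
  proof (cases "x = lab s")
    case True then show ?thesis using assms by (simp add: step_def)
  next
    case False then show ?thesis using step_adj[OF assms] dev_adj_level by blast
  qed
  then show "step s x \<in> \<Union>(range level)" "lab (step s x) = x" by auto
qed

text \<open>Homotopy lifting across a single simplex, degenerate triples included.\<close>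

lemma step_triangle:
  assumes s: "s \<in> \<Union>(range level)" and Y: "{lab s, x, y} \<in> Y"
  shows "step (step s x) y = step s y"
proof -
  have e: "{lab s, x} \<in> Y" "{lab s, y} \<in> Y" by (rule face[OF Y], simp, simp)+
  note lx = step_level[OF s e(1)]
  consider "x = lab s" | "y = x" | "y = lab s" "x \<noteq> lab s" | "lk (lab s) x y"
    using Y unfolding lk_def by blast
  then show ?thesis
  proof cases
    case 1 then show ?thesis by (simp add: step_def)
  next
    case 2 then show ?thesis using lx by (simp add: step_def)
  next
    case 3
    then show ?thesis using step_eqI[OF dev_adj_sym[OF step_adj(1)[OF s e(1)]]] by (simp add: step_def)
  next
    case 4
    then have "x \<noteq> lab s" "y \<noteq> lab s" by (auto simp: lk_def)
    note a = step_adj[OF s e(1) this(1)] step_adj[OF s e(2) this(2)]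
    then have "dev_adj (step s x) (step s y)" using dev_adj_triangle 4 by metis
    then show ?thesis using step_eqI a by metis
  qed
qed

end

section \<open>Lifting loops of the realisation\<close>

lemma openin_open_star:
  "openin (realisation K) {x \<in> topspace (realisation K). 0 < x v}"
  unfolding openin_realisation topspace_realisation
proof (intro conjI ballI)
  fix \<sigma> assume \<sigma>: "\<sigma> \<in> K"
  have "open {x :: 'a \<Rightarrow> real. 0 < x v}"
    by (intro open_Collect_less continuous_on_const continuous_on_product_coordinates)
  then have "openin (top_of_set (geometric_simplex \<sigma>)) (geometric_simplex \<sigma> \<inter> {x. 0 < x v})"
    by (rule openin_open_Int)
  moreover have "geometric_simplex \<sigma> \<inter> {x. 0 < x v} =
      {x \<in> \<Union>(geometric_simplex ` K). 0 < x v} \<inter> geometric_simplex \<sigma>"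
    using \<sigma> by blast
  ultimately show "openin (top_of_set (geometric_simplex \<sigma>))
      ({x \<in> \<Union>(geometric_simplex ` K). 0 < x v} \<inter> geometric_simplex \<sigma>)"
    by simp
qed auto

lemma positive_vertices_simplex:
  assumes "abstract_complex K" "x \<in> topspace (realisation K)" "A \<noteq> {}" "\<And>v. v \<in> A \<Longrightarrow> 0 < x v"
  shows "A \<in> K"
proof -
  obtain \<sigma> where "\<sigma> \<in> K" "x \<in> geometric_simplex \<sigma>"
    using assms(2) unfolding topspace_realisation by blast
  moreover have "A \<subseteq> \<sigma>"
    using \<open>x \<in> geometric_simplex \<sigma>\<close> assms(4) unfolding geometric_simplex_def by fastforce
  ultimately show ?thesis using assms(1,3) unfolding abstract_complex_def by blast
qed

lemma positive_vertex_exists: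
  assumes "x \<in> topspace (realisation K)"
  shows "\<exists>v\<in>\<Union>K. 0 < x v"
proof -
  obtain \<sigma> where \<sigma>: "\<sigma> \<in> K" "x \<in> geometric_simplex \<sigma>"
    using assms unfolding topspace_realisation by blast
  then have "\<exists>v\<in>\<sigma>. 0 < x v"
    unfolding geometric_simplex_def
    by (metis (mono_tags, lifting) less_eq_real_def mem_Collect_eq sum.neutral zero_neq_one)
  then show ?thesis using \<sigma> by blast
qed

lemma vertex_point_in_realisation:
  assumes "\<sigma> \<in> K" "finite \<sigma>" "v \<in> \<sigma>"
  shows "(\<lambda>w. if w = v then 1 else 0) \<in> topspace (realisation K)"
  unfolding topspace_realisation using assms
  by (intro UN_I[of \<sigma>]) (auto simp: geometric_simplex_def)

text \<open>The open stars of \<open>C\<close> and those of the remaining vertices cover the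
  realisation. A point common to both would be positive at some \<open>v\<close> in \<open>C\<close>
  and some \<open>w\<close> outside, and these would span an edge.\<close>

lemma connected_realisation_vertices:
  assumes K: "abstract_complex K" and conn: "connected_space (realisation K)"
    and "C \<noteq> {}" "C \<subseteq> \<Union>K" and closed: "\<And>v w. \<lbrakk>v \<in> C; {v, w} \<in> K\<rbrakk> \<Longrightarrow> w \<in> C"
  shows "C = \<Union>K"
proof (rule ccontr)
  assume "C \<noteq> \<Union>K"
  let ?T = "topspace (realisation K)"
  let ?S = "\<lambda>D. \<Union>v\<in>D. {x \<in> ?T. 0 < x v}"
  let ?\<delta> = "\<lambda>v w :: 'a. if w = v then 1 else 0 :: real"
  have op: "openin (realisation K) (?S D)" for D
  proof (rule openin_Union)
    fix U assume "U \<in> (\<lambda>v. {x \<in> ?T. 0 < x v}) ` D"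
    then obtain v where U: "U = {x \<in> ?T. 0 < x v}" by (rule imageE)
    show "openin (realisation K) U" unfolding U by (rule openin_open_star)
  qed
  have ne: "?S D \<noteq> {}" if D: "D \<noteq> {}" "D \<subseteq> \<Union>K" for D
  proof -
    obtain v \<sigma> where "v \<in> D" "v \<in> \<sigma>" "\<sigma> \<in> K" using D by blast
    moreover have "finite \<sigma>" using K \<open>\<sigma> \<in> K\<close> unfolding abstract_complex_def by blast
    ultimately have "?\<delta> v \<in> ?T" "0 < ?\<delta> v v" by (auto intro: vertex_point_in_realisation)
    then have "?\<delta> v \<in> ?S D" using \<open>v \<in> D\<close> by (intro UN_I[of v]) auto
    then show ?thesis by blast
  qed
  have "?T \<subseteq> ?S C \<union> ?S (\<Union>K - C)"
    using positive_vertex_exists by fastforce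
  moreover have "?S C \<inter> ?S (\<Union>K - C) = {}"
  proof (rule ccontr)
    assume "?S C \<inter> ?S (\<Union>K - C) \<noteq> {}"
    then obtain x v w where x: "x \<in> ?T" "v \<in> C" "0 < x v" "w \<notin> C" "0 < x w" by blast
    have "{v, w} \<in> K" by (rule positive_vertices_simplex[OF K x(1)]) (use x in auto)
    then show False using closed x by blast
  qed
  moreover have "?S C \<noteq> {}" "?S (\<Union>K - C) \<noteq> {}"
    using assms(3,4) \<open>C \<noteq> \<Union>K\<close> by (intro ne; blast)+
  ultimately show False
    using conn op unfolding connected_space_def by meson
qed

section \<open>Edge walks as paths, homotopies as grids\<close>

definition tent :: "real \<Rightarrow> real" where
  "tent y = max 0 (1 - \<bar>y\<bar>)"

text \<open>Written as a sum of tent functions, the path is visibly continuous in every coordinate.\<close>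

definition pl_path :: "(nat \<Rightarrow> 'a) \<Rightarrow> nat \<Rightarrow> real \<Rightarrow> 'a \<Rightarrow> real" where
  "pl_path x l t w = (\<Sum>k\<le>l. tent (t - real k) * (if w = x k then 1 else 0))"

lemma pl_path_segment:
  assumes "k < l" "real k \<le> t" "t \<le> real (Suc k)"
  shows "pl_path x l t = (\<lambda>w. (1 - (t - real k)) * (if w = x k then 1 else 0) +
           (t - real k) * (if w = x (Suc k) then 1 else 0))"
proof
  fix w
  have "pl_path x l t w = (\<Sum>i\<in>{k, Suc k}. tent (t - real i) * (if w = x i then 1 else 0))"
    unfolding pl_path_def
  proof (rule sum.mono_neutral_right)
    show "\<forall>i\<in>{..l} - {k, Suc k}. tent (t - real i) * (if w = x i then 1 else 0) = 0"
    proof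
      fix i assume "i \<in> {..l} - {k, Suc k}"
      then have "i + 1 \<le> k \<or> Suc k + 1 \<le> i" by auto
      then have "real i + 1 \<le> real k \<or> real (Suc k) + 1 \<le> real i"
        by (metis of_nat_1 of_nat_add of_nat_le_iff)
      then have "tent (t - real i) = 0" using assms unfolding tent_def by auto
      then show "tent (t - real i) * (if w = x i then 1 else 0) = 0" by simp
    qed
  qed (use assms in auto)
  also have "\<dots> = (1 - (t - real k)) * (if w = x k then 1 else 0) +
           (t - real k) * (if w = x (Suc k) then 1 else 0)"
    using assms by (simp add: tent_def)
  finally show "pl_path x l t w = \<dots>" .
qed

lemma pl_path_vertex:
  assumes "k \<le> l"
  shows "pl_path x l (real k) w = (if w = x k then 1 else 0)"
proof -
  have "pl_path x l (real k) w = (\<Sum>i\<in>{k}. tent (real k - real i) * (if w = x i then 1 else 0))"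
    unfolding pl_path_def
    by (rule sum.mono_neutral_right) (use assms in \<open>auto simp: tent_def abs_if\<close>)
  then show ?thesis by (simp add: tent_def)
qed

lemma pl_path_in_simplex:
  assumes "k < l" "real k \<le> t" "t \<le> real (Suc k)"
  shows "pl_path x l t \<in> geometric_simplex {x k, x (Suc k)}"
  unfolding pl_path_segment[OF assms] geometric_simplex_def using assms(2,3)
  by (cases "x k = x (Suc k)") auto

lemma unit_segments:
  assumes "0 < l" "0 \<le> t" "t \<le> real l"
  obtains k where "k < l" "real k \<le> t" "t \<le> real (Suc k)"
proof (cases "t = real l")
  case True
  then show ?thesis using that[of "l - 1"] assms(1) by (simp add: of_nat_diff)
next
  case False
  then have "nat \<lfloor>t\<rfloor> < l" using assms by linarith
  then show ?thesis using that[of "nat \<lfloor>t\<rfloor>"] assms by linarith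
qed

text \<open>Coordinatewise continuity gives continuity only for the product topology, which may be
  coarser than the weak one. Each segment stays in one closed simplex, where the two agree, and
  finitely many closed segments are pasted.\<close>

lemma pathin_pl_path:
  assumes "0 < l" and edge: "\<And>k. k < l \<Longrightarrow> {x k, x (Suc k)} \<in> K"
  shows "pathin (realisation K) (\<lambda>t. pl_path x l (real l * t))"
  unfolding pathin_def
proof (rule pasting_lemma_closed[where I = "{..<l}"
      and T = "\<lambda>k. {0..1} \<inter> {t. real k \<le> real l * t \<and> real l * t \<le> real (Suc k)}"
      and f = "\<lambda>k t. pl_path x l (real l * t)"])
  fix k assume "k \<in> {..<l}"
  then have k: "k < l" by simp
  let ?T = "{0..1::real} \<inter> {t. real k \<le> real l * t \<and> real l * t \<le> real (Suc k)}"
  have "closed {t. real k \<le> real l * t \<and> real l * t \<le> real (Suc k)}"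
    by (intro closed_Collect_conj closed_Collect_le continuous_intros)
  then show "closedin (top_of_set {0..1}) ?T"
    by (rule closedin_closed_Int)
  let ?g = "\<lambda>t. pl_path x l (real l * t)"
  have img: "?g ` ?T \<subseteq> geometric_simplex {x k, x (Suc k)}"
    using pl_path_in_simplex[OF k] by auto
  have "continuous_on ?T ?g"
    unfolding pl_path_def tent_def
    by (intro continuous_on_coordinatewise_then_product continuous_intros)
  then have "continuous_map (top_of_set ?T) (top_of_set (geometric_simplex {x k, x (Suc k)})) ?g"
    using img by (auto simp: continuous_map_in_subtopology)
  moreover have "continuous_map (top_of_set (geometric_simplex {x k, x (Suc k)})) (realisation K) id"
    unfolding continuous_map
  proof (intro conjI allI impI)
    show "id ` topspace (top_of_set (geometric_simplex {x k, x (Suc k)})) \<subseteq> topspace (realisation K)"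
      using edge[OF k] by (auto simp: topspace_realisation)
  next
    fix U assume "openin (realisation K) U"
    then have "openin (top_of_set (geometric_simplex {x k, x (Suc k)}))
        (U \<inter> geometric_simplex {x k, x (Suc k)})"
      using edge[OF k] unfolding openin_realisation by blast
    moreover have "U \<inter> geometric_simplex {x k, x (Suc k)} =
       {y \<in> topspace (top_of_set (geometric_simplex {x k, x (Suc k)})). id y \<in> U}" by auto
    ultimately show "openin (top_of_set (geometric_simplex {x k, x (Suc k)}))
       {y \<in> topspace (top_of_set (geometric_simplex {x k, x (Suc k)})). id y \<in> U}" by simp
  qed
  ultimately have "continuous_map (top_of_set ?T) (realisation K) (id \<circ> ?g)"
    by (rule continuous_map_compose)
  moreover have "subtopology (top_of_set {0..1}) ?T = top_of_set ?T"
    by (simp add: subtopology_subtopology Int_absorb1)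
  ultimately show "continuous_map (subtopology (top_of_set {0..1}) ?T) (realisation K) ?g"
    by (simp add: o_def)
next
  fix t assume "t \<in> topspace (top_of_set {0..1::real})"
  then have t: "0 \<le> t" "t \<le> 1" by auto
  then have "0 \<le> real l * t" "real l * t \<le> real l"
    by (auto simp: mult_left_le)
  then obtain k where "k < l" "real k \<le> real l * t" "real l * t \<le> real (Suc k)"
    using unit_segments[OF assms(1)] by metis
  then show "\<exists>j. j \<in> {..<l} \<and>
      t \<in> {0..1} \<inter> {t. real j \<le> real l * t \<and> real l * t \<le> real (Suc j)} \<and>
      pl_path x l (real l * t) = pl_path x l (real l * t)"
    using t by auto
qed auto

text \<open>\<open>v i j\<close> is a vertex whose open star contains the image of a neighbourhood of the grid point of
  index \<open>(i, j)\<close>; the mesh of the grid is governed by a Lebesgue number.\<close>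

lemma grid_approximation:
  assumes K: "abstract_complex K"
    and h: "continuous_map (prod_topology (top_of_set {0..1::real}) (top_of_set {0..1::real})) (realisation K) h"
    and "0 < l"
  obtains M :: nat and v :: "nat \<Rightarrow> nat \<Rightarrow> 'a" where "0 < M"
    "\<And>i j. \<lbrakk>i \<le> l * M; j \<le> l * M\<rbrakk> \<Longrightarrow> 0 < h (real i / real (l * M), real j / real (l * M)) (v i j)"
    "\<And>i j. \<lbrakk>i < l * M; j < l * M\<rbrakk> \<Longrightarrow> {v i j, v (Suc i) j, v i (Suc j), v (Suc i) (Suc j)} \<in> K"
proof -
  let ?Q = "{0..1::real} \<times> {0..1::real}"
  let ?T = "topspace (realisation K)"
  have pt: "prod_topology (top_of_set {0..1::real}) (top_of_set {0..1::real}) = top_of_set ?Q"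
    by (simp add: prod_topology_subtopology_eu)
  have hT: "h q \<in> ?T" if "q \<in> ?Q" for q
    using continuous_map_image_subset_topspace[OF h] that by (auto simp: pt)
  define P where "P w = {q \<in> ?Q. 0 < h q w}" for w
  have "openin (top_of_set ?Q) (P w)" for w
  proof -
    have "openin (top_of_set ?Q) {q \<in> topspace (top_of_set ?Q). h q \<in> {x \<in> ?T. 0 < x w}}"
      using h openin_open_star unfolding pt by (rule openin_continuous_map_preimage)
    moreover have "{q \<in> topspace (top_of_set ?Q). h q \<in> {x \<in> ?T. 0 < x w}} = P w"
      using hT by (auto simp: P_def)
    ultimately show ?thesis by simp
  qed
  then have "\<forall>w. \<exists>W. open W \<and> P w = ?Q \<inter> W"
    by (simp add: openin_open)
  then obtain W where W: "\<And>w. open (W w)" "\<And>w. P w = ?Q \<inter> W w" by metis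
  have cover: "?Q \<subseteq> \<Union>(range W)"
  proof
    fix q assume q: "q \<in> ?Q"
    then obtain w where "0 < h q w" using positive_vertex_exists hT by blast
    then have "q \<in> P w" using q by (simp add: P_def)
    then show "q \<in> \<Union>(range W)" using W by blast
  qed
  have "compact ?Q" by (intro compact_Times compact_Icc)
  then obtain e where e: "0 < e" "\<And>q. q \<in> ?Q \<Longrightarrow> \<exists>G\<in>range W. ball q e \<subseteq> G"
    using Heine_Borel_lemma[of ?Q "range W"] cover W(1) by blast
  then have "\<forall>q\<in>?Q. \<exists>w. ball q e \<subseteq> W w" by blast
  then obtain w where w: "\<And>q. q \<in> ?Q \<Longrightarrow> ball q e \<subseteq> W (w q)" by metis
  have near: "0 < h q' (w q)" if "q \<in> ?Q" "q' \<in> ?Q" "dist q q' < e" for q q'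
  proof -
    have "q' \<in> P (w q)" using w[OF that(1)] that W(2) by auto
    then show ?thesis by (simp add: P_def)
  qed
  \<comment> \<open>The 2 pays for one mesh width in each of the two coordinates.\<close>
  obtain M :: nat where M: "2 / e < real M" using reals_Archimedean2 by blast
  then have "0 < M" using e(1) by (metis divide_pos_pos gr0I less_asym of_nat_0 zero_less_numeral)
  \<comment> \<open>A multiple of \<open>l\<close>, so that the \<open>l\<close> corners of an edge
    loop fall on grid points.\<close>
  let ?N = "l * M"
  have N: "0 < ?N" using \<open>0 < M\<close> \<open>0 < l\<close> by simp
  have "M \<le> ?N" using \<open>0 < l\<close> by (cases l) auto
  then have "real M \<le> real ?N" by (rule of_nat_mono)
  then have "2 / e < real ?N" using M by linarith
  then have small: "2 / real ?N < e" using e(1) N by (simp add: field_simps)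
  define q where "q i j = (real i / real ?N, real j / real ?N)" for i j
  have qQ: "q i j \<in> ?Q" if "i \<le> ?N" "j \<le> ?N" for i j
  proof -
    have "real i \<le> real ?N" "real j \<le> real ?N" using that of_nat_le_iff by blast+
    then show ?thesis using N unfolding q_def by (simp add: divide_le_eq)
  qed
  have qd: "dist (q i' j') (q i j) < e" if "i' \<in> {i, Suc i}" "j' \<in> {j, Suc j}" for i j i' j'
  proof -
    have a: "\<bar>real i' / real ?N - real i / real ?N\<bar> \<le> 1 / real ?N"
      using that by (auto simp: add_divide_distrib)
    have b: "\<bar>real j' / real ?N - real j / real ?N\<bar> \<le> 1 / real ?N"
      using that by (auto simp: add_divide_distrib)
    have "dist (q i' j') (q i j) \<le> \<bar>real i' / real ?N - real i / real ?N\<bar> + \<bar>real j' / real ?N - real j / real ?N\<bar>"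
      unfolding q_def dist_Pair_Pair dist_real_def
      by (rule order_trans[OF sqrt_sum_squares_le_sum_abs]) simp
    also have "\<dots> \<le> 1 / real ?N + 1 / real ?N" by (rule add_mono[OF a b])
    also have "\<dots> = 2 / real ?N" by (simp flip: add_divide_distrib)
    also have "\<dots> < e" by (rule small)
    finally show ?thesis .
  qed
  show ?thesis
  proof (rule that[of M "\<lambda>i j. w (q i j)"])
    show "0 < M" by fact
    show "0 < h (real i / real ?N, real j / real ?N) (w (q i j))" if "i \<le> ?N" "j \<le> ?N" for i j
      using near[OF qQ qQ, OF that that] e(1) by (simp add: q_def)
    \<comment> \<open>All four vertices are positive at the image of the single point
      \<open>q i j\<close>, since it is \<open>e\<close>-close to every corner of the cell.\<close>
    show "{w (q i j), w (q (Suc i) j), w (q i (Suc j)), w (q (Suc i) (Suc j))} \<in> K"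
      if "i < ?N" "j < ?N" for i j
    proof (rule positive_vertices_simplex[OF K hT[OF qQ]])
      show "i \<le> ?N" "j \<le> ?N" using that by auto
      fix u assume "u \<in> {w (q i j), w (q (Suc i) j), w (q i (Suc j)), w (q (Suc i) (Suc j))}"
      then obtain i' j' where ij: "i' \<in> {i, Suc i}" "j' \<in> {j, Suc j}" "u = w (q i' j')" by blast
      then have "i' \<le> ?N" "j' \<le> ?N" using that by auto
      then show "0 < h (q i j) u" using near[OF qQ qQ qd] ij that by simp
    qed simp
  qed
qed

text \<open>\<open>T\<close> is the vertex set of a covering complex, \<open>lab\<close> the projection, and \<open>step s y\<close> the
  neighbour of \<open>s\<close> above \<open>y\<close>.\<close>

locale transport =
  fixes K :: "'a set set" and T :: "'b set" and lab :: "'b \<Rightarrow> 'a" and step :: "'b \<Rightarrow> 'a \<Rightarrow> 'b"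
  assumes K: "abstract_complex K"
    and step_in: "\<lbrakk>s \<in> T; {lab s, x} \<in> K\<rbrakk> \<Longrightarrow> step s x \<in> T"
    and lab_step: "\<lbrakk>s \<in> T; {lab s, x} \<in> K\<rbrakk> \<Longrightarrow> lab (step s x) = x"
    and step_step: "\<lbrakk>s \<in> T; {lab s, x, y} \<in> K\<rbrakk> \<Longrightarrow> step (step s x) y = step s y"
    and step_lab: "s \<in> T \<Longrightarrow> step s (lab s) = s"
begin

section \<open>Discrete homotopy lifting\<close>

fun lift :: "'b \<Rightarrow> (nat \<Rightarrow> 'a) \<Rightarrow> nat \<Rightarrow> 'b" where
  "lift s x 0 = s"
| "lift s x (Suc k) = step (lift s x k) (x (Suc k))"

lemma lift_in:
  assumes "s \<in> T" "lab s = x 0" "\<And>k. k < l \<Longrightarrow> {x k, x (Suc k)} \<in> K" "k \<le> l"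
  shows "lift s x k \<in> T" "lab (lift s x k) = x k"
proof -
  have "lift s x k \<in> T \<and> lab (lift s x k) = x k"
    using \<open>k \<le> l\<close>
  proof (induction k)
    case (Suc k)
    then have "{lab (lift s x k), x (Suc k)} \<in> K" using assms(3) by simp
    then show ?case using Suc step_in lab_step by simp
  qed (use assms in simp)
  then show "lift s x k \<in> T" "lab (lift s x k) = x k" by auto
qed

text \<open>Here \<open>i\<close> is the homotopy parameter and \<open>j\<close> the loop parameter.
  Lifting the whole grid is consistent around each cell, and the three constant sides lift to
  constant walks; hence the remaining side \<open>v 0\<close> ends where it began.\<close>

lemma lift_grid:
  assumes s: "s \<in> T" "lab s = v 0 0"
    and cell: "\<And>i j. \<lbrakk>i < N; j < N\<rbrakk> \<Longrightarrow> {v i j, v (Suc i) j, v i (Suc j), v (Suc i) (Suc j)} \<in> K"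
    and bd: "\<And>i. i \<le> N \<Longrightarrow> v i 0 = v 0 0 \<and> v i N = v 0 0" "\<And>j. j \<le> N \<Longrightarrow> v N j = v 0 0"
    and "0 < N"
  shows "lift s (v 0) N = s"
proof -
  define W where "W i j = lift (lift s (v 0) j) (\<lambda>i. v i j) i" for i j
  have row0: "lift s (v 0) j \<in> T \<and> lab (lift s (v 0) j) = v 0 j" if "j \<le> N" for j
  proof -
    have "{v 0 k, v 0 (Suc k)} \<in> K" if "k < N" for k
      by (rule abstract_complex_face[OF K cell[OF \<open>0 < N\<close> that]]) auto
    then show ?thesis using lift_in[of s "v 0" N j] s that by auto
  qed
  have col: "{v k j, v (Suc k) j} \<in> K" if "k < N" "j \<le> N" for k j
  proof (cases "j < N")
    case True
    show ?thesis by (rule abstract_complex_face[OF K cell[OF that(1) True]]) auto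
  next
    case False
    then have j: "j = Suc (N - 1)" "N - 1 < N" using that \<open>0 < N\<close> by auto
    show ?thesis by (subst (1 2) j, rule abstract_complex_face[OF K cell[OF that(1) j(2)]]) auto
  qed
  have WT: "W i j \<in> T" "lab (W i j) = v i j" if "i \<le> N" "j \<le> N" for i j
    using lift_in[of "lift s (v 0) j" "\<lambda>i. v i j" N i] row0[OF that(2)] col that
    unfolding W_def by auto
  \<comment> \<open>Both ways around a cell to its opposite corner lie over one simplex, so each
    equals the single diagonal step.\<close>
  have across: "step (W i j) (v i (Suc j)) = W i (Suc j)" if "i \<le> N" "j < N" for i j
    using that(1)
  proof (induction i)
    case 0 then show ?case by (simp add: W_def)
  next
    case (Suc i)
    then have i: "i < N" "i \<le> N" by auto
    have j: "j \<le> N" "Suc j \<le> N" using that by auto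
    let ?y = "v (Suc i) (Suc j)"
    note c = cell[OF i(1) that(2)]
    have "{lab (W i j), v (Suc i) j, ?y} \<in> K"
      by (rule abstract_complex_face[OF K c]) (use WT(2)[OF i(2) j(1)] in auto)
    then have "step (step (W i j) (v (Suc i) j)) ?y = step (W i j) ?y"
      using step_step WT(1) i j by blast
    moreover have "{lab (W i j), v i (Suc j), ?y} \<in> K"
      by (rule abstract_complex_face[OF K c]) (use WT(2)[OF i(2) j(1)] in auto)
    then have "step (step (W i j) (v i (Suc j))) ?y = step (W i j) ?y"
      using step_step WT(1) i j by blast
    ultimately show ?case using Suc.IH i by (simp add: W_def)
  qed
  have left: "W i 0 = s" if "i \<le> N" for i
    using that
  proof (induction i)
    case 0 then show ?case by (simp add: W_def)
  next
    case (Suc i)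
    then have "W (Suc i) 0 = step s (v (Suc i) 0)" by (simp add: W_def)
    then show ?case using Suc.prems bd(1) s step_lab by metis
  qed
  have top: "W N j = s" if "j \<le> N" for j
    using that
  proof (induction j)
    case 0 then show ?case using left by simp
  next
    case (Suc j)
    then have "W N (Suc j) = step s (v N (Suc j))" using across[of N j] by simp
    then show ?case using Suc.prems bd(2) s step_lab by metis
  qed
  have right: "W i N = W 0 N" if "i \<le> N" for i
    using that
  proof (induction i)
    case 0 then show ?case by simp
  next
    case (Suc i)
    then have "W (Suc i) N = step (W 0 N) (v (Suc i) N)" by (simp add: W_def)
    moreover have "lab (W 0 N) = v (Suc i) N" using WT(2)[of 0 N] bd(1) Suc.prems by (metis le_refl zero_le)
    ultimately show ?case using step_lab WT(1)[of 0 N] by (metis le_refl zero_le)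
  qed
  show ?thesis using right[of N] top[of N] by (simp add: W_def)
qed

text \<open>Between \<open>k * M\<close> and \<open>Suc k * M\<close> the finer walk stays over one
  edge, so by \<open>step_step\<close> its lift depends only on the current label.\<close>

lemma lift_subdivision:
  assumes s: "s \<in> T" "lab s = x 0" and edge: "\<And>k. k < l \<Longrightarrow> {x k, x (Suc k)} \<in> K"
    and y: "\<And>k r. \<lbrakk>k < l; r \<le> M\<rbrakk> \<Longrightarrow> y (k * M + r) \<in> {x k, x (Suc k)}"
    and yv: "\<And>k. k \<le> l \<Longrightarrow> y (k * M) = x k" and "0 < M"
  shows "k \<le> l \<Longrightarrow> lift s y (k * M) = lift s x k"
proof (induction k)
  case (Suc k)
  then have k: "k < l" and IH: "lift s y (k * M) = lift s x k" by auto
  note X = lift_in[OF s edge, of l k] 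
  have XT: "lift s x k \<in> T" "lab (lift s x k) = x k" using X k by auto
  have "r \<le> M \<Longrightarrow> lift s y (k * M + r) = step (lift s x k) (y (k * M + r))" for r
  proof (induction r)
    case 0 then show ?case using IH yv[of k] k step_lab[OF XT(1)] XT(2) by simp
  next
    case (Suc r)
    have "{x k, y (k * M + r), y (k * M + Suc r)} \<in> K"
      by (rule abstract_complex_face[OF K edge[OF k]]) (use y[OF k, of r] y[OF k, of "Suc r"] Suc.prems in auto)
    then show ?case using Suc step_step XT by simp
  qed
  from this[of M] show ?case using yv[of "Suc k"] Suc.prems by (simp add: add.commute)
qed simp

text \<open>Approximating a null-homotopy of the loop \<open>pl_path\<close> on a grid gives a first
  row that subdivides \<open>x\<close>. Its lift closes up by \<open>lift_grid\<close> and ends at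
  the same point as the lift of \<open>x\<close> by \<open>lift_subdivision\<close>.\<close>

lemma closed_walk_lift:
  assumes sc: "simply_connected_top (realisation K)"
    and s: "s \<in> T" "lab s = x 0" and edge: "\<And>k. k < l \<Longrightarrow> {x k, x (Suc k)} \<in> K" and "x l = x 0"
  shows "lift s x l = s"
proof (cases "l = 0")
  case False
  then have l: "0 < l" by simp
  let ?p = "\<lambda>t. pl_path x l (real l * t)"
  let ?\<delta> = "\<lambda>w. if w = x 0 then 1 else 0 :: real"
  have p: "pathin (realisation K) ?p" using l edge by (rule pathin_pl_path)
  have p0: "?p 0 = ?\<delta>" using pl_path_vertex[of 0 l x] by auto
  have p1: "?p 1 = ?\<delta>" using pl_path_vertex[of l l x] \<open>x l = x 0\<close> by auto
  have "homotopic_with (\<lambda>q. q 0 = ?p 0 \<and> q 1 = ?p 0) (top_of_set {0..1}) (realisation K) ?p (\<lambda>_. ?p 0)"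
    using sc p p0 p1 unfolding simply_connected_top_def by (elim conjE allE[of _ ?p]) simp
  then obtain h where h: "continuous_map (prod_topology (top_of_set {0..1::real}) (top_of_set {0..1::real})) (realisation K) h"
      "\<forall>t. h (0, t) = ?p t" "\<forall>t. h (1, t) = ?p 0" "\<forall>t\<in>{0..1}. h (t, 0) = ?p 0 \<and> h (t, 1) = ?p 0"
    unfolding homotopic_with_def by blast
  have h2: "h (0, t) = ?p t" and h3: "h (1, t) = ?\<delta>" for t
    using h(2,3) p0 by auto
  have h4: "h (t, 0) = ?\<delta>" "h (t, 1) = ?\<delta>" if "t \<in> {0..1}" for t
    using h(4) p0 that by auto
  obtain M v where M: "0 < M"
    and pos: "\<And>i j. \<lbrakk>i \<le> l * M; j \<le> l * M\<rbrakk> \<Longrightarrow> 0 < h (real i / real (l * M), real j / real (l * M)) (v i j)"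
    and cell: "\<And>i j. \<lbrakk>i < l * M; j < l * M\<rbrakk> \<Longrightarrow> {v i j, v (Suc i) j, v i (Suc j), v (Suc i) (Suc j)} \<in> K"
    using grid_approximation[OF K h(1) l] by metis
  let ?N = "l * M"
  have N: "0 < ?N" using M l by simp
  have \<delta>D: "u = x 0" if "0 < ?\<delta> u" for u using that by (auto split: if_splits)
  have unit: "real i / real ?N \<in> {0..1}" if "i \<le> ?N" for i
  proof -
    have "real i \<le> real ?N" using that of_nat_le_iff by blast
    then show ?thesis using N by (simp add: divide_le_eq)
  qed
  \<comment> \<open>On these three sides the homotopy is constantly the point of the vertex
    \<open>x 0\<close>, whose only positive coordinate leaves no choice for
    \<open>v\<close>.\<close>
  have bd: "v i 0 = x 0" "v i ?N = x 0" "v ?N i = x 0" if "i \<le> ?N" for i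
  proof -
    have 1: "real ?N / real ?N = 1" "real 0 / real ?N = 0" using N by auto
    show "v i 0 = x 0" using pos[OF that le0] unfolding 1 h4(1)[OF unit[OF that]] by (rule \<delta>D)
    show "v i ?N = x 0" using pos[OF that le_refl] unfolding 1 h4(2)[OF unit[OF that]] by (rule \<delta>D)
    show "v ?N i = x 0" using pos[OF le_refl that] unfolding 1 h3 by (rule \<delta>D)
  qed
  have row: "0 < pl_path x l (real j / real M) (v 0 j)" if "j \<le> ?N" for j
  proof -
    have "real l * (real j / real ?N) = real j / real M" using l M by simp
    then show ?thesis using pos[OF _ that, of 0] h2 by simp
  qed
  have vv: "v 0 (k * M) = x k" if "k \<le> l" for k
  proof -
    have "k * M \<le> ?N" using that by simp
    from row[OF this] have "0 < pl_path x l (real k) (v 0 (k * M))" using M by simp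
    then show ?thesis using pl_path_vertex[OF that] by (metis less_irrefl)
  qed
  have vs: "v 0 (k * M + r) \<in> {x k, x (Suc k)}" if "k < l" "r \<le> M" for k r
  proof -
    have "k * M + r \<le> (k + 1) * M" using that by simp
    also have "\<dots> \<le> ?N" using that by (intro mult_right_mono) auto
    finally have le: "k * M + r \<le> ?N" .
    have "real (k * M + r) / real M = real k + real r / real M" using M by (simp add: add_divide_distrib)
    moreover have "real r / real M \<le> 1" using that M by simp
    ultimately have "pl_path x l (real (k * M + r) / real M) \<in> geometric_simplex {x k, x (Suc k)}"
      by (intro pl_path_in_simplex[OF that(1)]) auto
    then show ?thesis using row[OF le] unfolding geometric_simplex_def by fastforce
  qed
  have "lift s (v 0) ?N = s"
    using bd[of 0] s cell bd N by (intro lift_grid) auto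
  moreover have "lift s (v 0) ?N = lift s x l"
    using lift_subdivision[OF s edge, of l M "v 0" l] vs vv M by blast
  ultimately show ?thesis by simp
qed simp

end

section \<open>Property A from a coalescing descent\<close>

text \<open>Twice the probability that the simple random walk started at \<open>m\<close> has not reached \<open>0\<close> by
  time \<open>j\<close>.\<close>

fun coupling_bound :: "nat \<Rightarrow> nat \<Rightarrow> real" where
  "coupling_bound j 0 = 0"
| "coupling_bound 0 (Suc m) = 2"
| "coupling_bound (Suc j) (Suc m) = (coupling_bound j m + coupling_bound j (Suc (Suc m))) / 2"

lemma coupling_bound_range: "0 \<le> coupling_bound j m \<and> coupling_bound j m \<le> 2"
proof (induction j arbitrary: m)
  case 0 then show ?case by (cases m) auto
next
  case (Suc j)
  show ?case
  proof (cases m)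
    case (Suc k)
    then show ?thesis using Suc.IH[of k] Suc.IH[of "Suc (Suc k)"] by auto
  qed simp
qed

lemma coupling_bound_decreasing: "coupling_bound (Suc j) m \<le> coupling_bound j m"
proof (induction j arbitrary: m)
  case 0
  show ?case using coupling_bound_range[of "Suc 0" m] by (cases m) auto
next
  case (Suc j)
  show ?case
  proof (cases m)
    case (Suc k)
    then show ?thesis
      using divide_right_mono[OF add_mono[OF Suc.IH[of k] Suc.IH[of "Suc (Suc k)"]], of 2]
      by (simp only: coupling_bound.simps)
  qed simp
qed

text \<open>The limit is a bounded harmonic function on the half line that vanishes at \<open>0\<close>.\<close>

lemma coupling_bound_tendsto_0: "(\<lambda>j. coupling_bound j m) \<longlonglongrightarrow> 0"
proof -
  have "convergent (\<lambda>j. coupling_bound j m)" for m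
  proof (rule Bseq_monoseq_convergent)
    show "Bseq (\<lambda>j. coupling_bound j m)"
      by (rule BseqI'[of _ 2]) (use coupling_bound_range in auto)
    show "monoseq (\<lambda>j. coupling_bound j m)"
      by (rule decseq_imp_monoseq) (simp add: decseq_SucI coupling_bound_decreasing)
  qed
  then obtain L where L: "\<And>m. (\<lambda>j. coupling_bound j m) \<longlonglongrightarrow> L m"
    unfolding convergent_def by metis
  have L0: "L 0 = 0" using LIMSEQ_unique[OF L[of 0], of 0] by simp
  have harm: "L (Suc m) = (L m + L (Suc (Suc m))) / 2" for m
  proof (rule LIMSEQ_unique)
    show "(\<lambda>j. coupling_bound (Suc j) (Suc m)) \<longlonglongrightarrow> L (Suc m)"
      using L[of "Suc m"] by (rule LIMSEQ_Suc)
    show "(\<lambda>j. coupling_bound (Suc j) (Suc m)) \<longlonglongrightarrow> (L m + L (Suc (Suc m))) / 2"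
      unfolding coupling_bound.simps by (intro tendsto_intros L) simp
  qed
  have lin: "L m = real m * L 1 \<and> L (Suc m) = real (Suc m) * L 1" for m
  proof (induction m)
    case (Suc m)
    then show ?case using harm[of m] by (simp add: field_simps)
  qed (simp add: L0)
  have bd: "0 \<le> L m" "L m \<le> 2" for m
  proof -
    show "0 \<le> L m" by (rule LIMSEQ_le_const[OF L]) (use coupling_bound_range in blast)
    show "L m \<le> 2" by (rule LIMSEQ_le_const2[OF L]) (use coupling_bound_range in blast)
  qed
  have "L 1 = 0"
  proof (rule ccontr)
    assume "L 1 \<noteq> 0"
    then have "0 < L 1" using bd(1)[of 1] by simp
    then obtain k :: nat where "2 < real k * L 1" using reals_Archimedean3 by blast
    then show False using lin[of k] bd(2)[of k] by simp
  qed
  then show ?thesis using L[of m] lin[of m] by simp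
qed

lemma cesaro_tendsto_0:
  fixes u :: "nat \<Rightarrow> real"
  assumes u: "u \<longlonglongrightarrow> 0"
  shows "(\<lambda>n. (\<Sum>j\<le>n. u j) / real (Suc n)) \<longlonglongrightarrow> 0"
proof (rule LIMSEQ_I)
  fix e :: real assume e: "0 < e"
  obtain N where N: "\<And>n. N \<le> n \<Longrightarrow> \<bar>u n\<bar> < e / 2"
    using LIMSEQ_D[OF u, of "e / 2"] e by auto
  define A where "A = (\<Sum>j<N. \<bar>u j\<bar>)"
  obtain M :: nat where M: "2 * A / e < real M" using reals_Archimedean2 by blast
  show "\<exists>n0. \<forall>n\<ge>n0. norm ((\<Sum>j\<le>n. u j) / real (Suc n) - 0) < e"
  proof (intro exI allI impI)
    fix n assume n: "max N M \<le> n"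
    have "\<bar>\<Sum>j\<le>n. u j\<bar> \<le> (\<Sum>j\<le>n. \<bar>u j\<bar>)" by (rule sum_abs)
    also have "\<dots> \<le> (\<Sum>j\<le>n. (if j < N then \<bar>u j\<bar> else 0) + e / 2)"
      using N e by (intro sum_mono) (auto simp: not_less less_imp_le)
    also have "\<dots> = (\<Sum>j\<le>n. if j < N then \<bar>u j\<bar> else 0) + real (Suc n) * (e / 2)"
      by (simp add: sum.distrib)
    also have "(\<Sum>j\<le>n. if j < N then \<bar>u j\<bar> else 0) = A"
      unfolding A_def using n by (intro sum.mono_neutral_cong_right) auto
    also have "A < real (Suc n) * (e / 2)"
    proof -
      have "2 * A / e < real (Suc n)" using M n by linarith
      then show ?thesis using e by (simp add: field_simps)
    qed
    finally have "\<bar>\<Sum>j\<le>n. u j\<bar> < real (Suc n) * e" by (simp add: field_simps)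
    then show "norm ((\<Sum>j\<le>n. u j) / real (Suc n) - 0) < e"
      by (simp add: field_simps abs_mult)
  qed
qed

section \<open>The l1-norm of finitely supported functions\<close>

abbreviation finite_support :: "('a \<Rightarrow> real) \<Rightarrow> bool" where
  "finite_support g \<equiv> finite {w. g w \<noteq> 0}"

lemma finite_support_summable: "finite_support g \<Longrightarrow> (\<lambda>w. \<bar>g w\<bar>) summable_on V"
  by (rule finite_nonzero_values_imp_summable_on) (auto elim: rev_finite_subset)

lemma finite_support_add:
  assumes "finite_support g" "finite_support h"
  shows "finite_support (\<lambda>w. g w + h w)"
  by (rule finite_subset[of _ "{w. g w \<noteq> 0} \<union> {w. h w \<noteq> 0}"]) (use assms in auto)

lemma finite_support_diff:
  assumes "finite_support g" "finite_support h"
  shows "finite_support (\<lambda>w. g w - h w)"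
  by (rule finite_subset[of _ "{w. g w \<noteq> 0} \<union> {w. h w \<noteq> 0}"]) (use assms in auto)

lemma finite_support_cmult: "finite_support g \<Longrightarrow> finite_support (\<lambda>w. c * g w)"
  by (rule finite_subset[of _ "{w. g w \<noteq> 0}"]) auto

lemma finite_support_sum:
  "finite J \<Longrightarrow> (\<And>j. j \<in> J \<Longrightarrow> finite_support (g j)) \<Longrightarrow> finite_support (\<lambda>w. \<Sum>j\<in>J. g j w)"
proof (induction J rule: finite_induct)
  case (insert j J)
  then show ?case using finite_support_add[of "g j"] by simp
qed simp

lemma l1_norm_on_nonneg: "0 \<le> l1_norm_on V g"
  unfolding l1_norm_on_def by (rule infsum_nonneg) simp

lemma l1_norm_on_zero: "l1_norm_on V (\<lambda>w. 0) = 0"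
  unfolding l1_norm_on_def by simp

lemma l1_norm_on_add:
  assumes "finite_support g" "finite_support h"
  shows "l1_norm_on V (\<lambda>w. g w + h w) \<le> l1_norm_on V g + l1_norm_on V h"
proof -
  have "l1_norm_on V (\<lambda>w. g w + h w) \<le> (\<Sum>\<^sub>\<infinity>w\<in>V. \<bar>g w\<bar> + \<bar>h w\<bar>)"
    unfolding l1_norm_on_def
    by (intro infsum_mono finite_support_summable finite_support_add summable_on_add assms abs_triangle_ineq)
  also have "\<dots> = l1_norm_on V g + l1_norm_on V h"
    unfolding l1_norm_on_def by (intro infsum_add finite_support_summable assms)
  finally show ?thesis .
qed

lemma l1_norm_on_add_nonneg:
  assumes "finite_support g" "finite_support h" "\<And>w. 0 \<le> g w" "\<And>w. 0 \<le> h w"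
  shows "l1_norm_on V (\<lambda>w. g w + h w) = l1_norm_on V g + l1_norm_on V h"
proof -
  have "l1_norm_on V (\<lambda>w. g w + h w) = (\<Sum>\<^sub>\<infinity>w\<in>V. \<bar>g w\<bar> + \<bar>h w\<bar>)"
    unfolding l1_norm_on_def using assms(3,4) by (intro infsum_cong) simp
  also have "\<dots> = l1_norm_on V g + l1_norm_on V h"
    unfolding l1_norm_on_def by (intro infsum_add finite_support_summable assms)
  finally show ?thesis .
qed

lemma l1_norm_on_cmult: "0 \<le> c \<Longrightarrow> l1_norm_on V (\<lambda>w. c * g w) = c * l1_norm_on V g"
  unfolding l1_norm_on_def by (simp add: abs_mult infsum_cmult_right')

lemma l1_norm_on_uminus_diff: "l1_norm_on V (\<lambda>w. g w - h w) = l1_norm_on V (\<lambda>w. h w - g w)"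
  unfolding l1_norm_on_def by (simp add: abs_minus_commute)

lemma l1_norm_on_sum:
  "finite J \<Longrightarrow> (\<And>j. j \<in> J \<Longrightarrow> finite_support (g j)) \<Longrightarrow>
    l1_norm_on V (\<lambda>w. \<Sum>j\<in>J. g j w) \<le> (\<Sum>j\<in>J. l1_norm_on V (g j))"
proof (induction J rule: finite_induct)
  case (insert j J)
  then show ?case
    using l1_norm_on_add[of "g j" "\<lambda>w. \<Sum>j\<in>J. g j w" V] finite_support_sum[of J g] by simp
qed (simp add: l1_norm_on_zero)

lemma l1_norm_on_sum_nonneg:
  "finite J \<Longrightarrow> (\<And>j. j \<in> J \<Longrightarrow> finite_support (g j)) \<Longrightarrow> (\<And>j w. 0 \<le> g j w) \<Longrightarrow>
    l1_norm_on V (\<lambda>w. \<Sum>j\<in>J. g j w) = (\<Sum>j\<in>J. l1_norm_on V (g j))"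
proof (induction J rule: finite_induct)
  case (insert j J)
  then show ?case
    using l1_norm_on_add_nonneg[of "g j" "\<lambda>w. \<Sum>j\<in>J. g j w" V] finite_support_sum[of J g]
    by (simp add: sum_nonneg)
qed (simp add: l1_norm_on_zero)

lemma l1_norm_on_point:
  assumes "v \<in> V"
  shows "l1_norm_on V (\<lambda>w. if w = v then 1 else 0) = 1"
proof -
  have "l1_norm_on V (\<lambda>w. if w = v then 1 else 0) = (\<Sum>\<^sub>\<infinity>w\<in>{v}. 1)"
    unfolding l1_norm_on_def by (rule infsum_cong_neutral) (use assms in auto)
  then show ?thesis by simp
qed

text \<open>A vertex off the base point has one or two lower neighbours \<open>a v\<close> and \<open>b v\<close>; at the base
  point \<open>a\<close> and \<open>b\<close> are the identity.\<close>

locale descent =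
  fixes G :: "'a graph" and lev :: "'a \<Rightarrow> nat" and a b :: "'a \<Rightarrow> 'a"
  assumes graph: "simple_graph G"
    and down: "v \<in> verts G \<Longrightarrow> a v \<in> verts G \<and> b v \<in> verts G"
    and down_edge: "v \<in> verts G \<Longrightarrow> (a v = v \<or> {v, a v} \<in> edges G) \<and> (b v = v \<or> {v, b v} \<in> edges G)"
    and down_pair: "\<lbrakk>v \<in> verts G; a v \<noteq> b v\<rbrakk> \<Longrightarrow> {a v, b v} \<in> edges G \<and> lev (a v) = lev (b v)"
    and horizontal: "\<lbrakk>{v, w} \<in> edges G; lev v = lev w\<rbrakk> \<Longrightarrow> {a v, b v} \<inter> {a w, b w} \<noteq> {}"
    and vertical: "\<lbrakk>{v, w} \<in> edges G; lev v \<noteq> lev w\<rbrakk> \<Longrightarrow> v \<in> {a w, b w} \<or> w \<in> {a v, b v}"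
begin

section \<open>Coupling of two descending particles\<close>

text \<open>Reflexive on vertices, so that the \<open>m\<close>-th relational power expresses
  horizontal distance at most \<open>m\<close>.\<close>

definition level_step :: "'a \<Rightarrow> 'a \<Rightarrow> bool" where
  "level_step x y \<longleftrightarrow> x \<in> verts G \<and> y \<in> verts G \<and> (x = y \<or> {x, y} \<in> edges G \<and> lev x = lev y)"

lemma edge_verts: "{v, w} \<in> edges G \<Longrightarrow> v \<in> verts G \<and> w \<in> verts G"
  using graph unfolding simple_graph_def by (auto dest!: bspec[of _ _ "{v, w}"])

lemma level_step_down:
  assumes "v \<in> verts G" "c \<in> {a v, b v}" "d \<in> {a v, b v}"
  shows "level_step c d"
  using assms down[OF assms(1)] down_pair[OF assms(1)] unfolding level_step_def
  by (cases "a v = b v") (auto simp: insert_commute)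

lemma level_step_common:
  assumes "level_step x y"
  shows "\<exists>c. c \<in> {a x, b x} \<and> c \<in> {a y, b y}"
  using assms horizontal unfolding level_step_def by blast

text \<open>Consecutive vertices of the path share a lower neighbour. Two successive shared ones lie
  below the same vertex and are thus equal or adjacent, so they form a path with one step
  less.\<close>

lemma level_path_down:
  assumes "(level_step ^^ Suc m) x y"
  shows "\<exists>c\<in>{a x, b x}. \<exists>d\<in>{a y, b y}. (level_step ^^ m) c d"
  using assms
proof (induction m arbitrary: y)
  case 0
  then show ?case using level_step_common by auto
next
  case (Suc m)
  then obtain z where z: "(level_step ^^ Suc m) x z" "level_step z y" by auto
  then obtain c d where cd: "c \<in> {a x, b x}" "d \<in> {a z, b z}" "(level_step ^^ m) c d"
    using Suc.IH by blast
  obtain e where e: "e \<in> {a z, b z}" "e \<in> {a y, b y}" using level_step_common z by blast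
  have "level_step d e" using z(2) cd e level_step_down unfolding level_step_def by blast
  then have "(level_step ^^ Suc m) c e" using cd by auto
  then show ?case using cd e by blast
qed

text \<open>This is \<open>2 ^ j\<close> times the law of the walk after \<open>j\<close> steps;
  when \<open>a v = b v\<close> the branch counts twice, which keeps the total mass equal to
  \<open>2 ^ j\<close>.\<close>

primrec descend :: "nat \<Rightarrow> 'a \<Rightarrow> 'a \<Rightarrow> nat" where
  "descend 0 v w = (if w = v then 1 else 0)"
| "descend (Suc j) v w = descend j (a v) w + descend j (b v) w"

abbreviation D :: "nat \<Rightarrow> 'a \<Rightarrow> 'a \<Rightarrow> real" where
  "D j v w \<equiv> real (descend j v w)"

abbreviation N :: "('a \<Rightarrow> real) \<Rightarrow> real" where
  "N \<equiv> l1_norm_on (verts G)"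

lemma finite_support_descend: "finite_support (D j v)"
proof (induction j arbitrary: v)
  case (Suc j)
  show ?case using finite_support_add[OF Suc Suc, of "a v" "b v"] by simp
qed simp

lemma norm_descend: "v \<in> verts G \<Longrightarrow> N (D j v) = 2 ^ j"
proof (induction j arbitrary: v)
  case 0
  have "D 0 v = (\<lambda>w. if w = v then 1 else 0)" by auto
  then show ?case using l1_norm_on_point 0 by simp
next
  case (Suc j)
  have "N (D (Suc j) v) = N (D j (a v)) + N (D j (b v))"
    using l1_norm_on_add_nonneg[OF finite_support_descend finite_support_descend, where V = "verts G"]
    by simp
  then show ?case using Suc down by simp
qed

text \<open>The recursion of \<open>coupling_bound\<close> mirrors the coupling: one pair of
  branches comes one step closer, the complementary pair at most one step further apart. The initial
  value 2 is the distance of two distinct unit masses.\<close>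

lemma norm_descend_diff:
  assumes "(level_step ^^ m) x y" "x \<in> verts G" "y \<in> verts G"
  shows "N (\<lambda>w. D j x w - D j y w) \<le> 2 ^ j * coupling_bound j m"
  using assms
proof (induction j arbitrary: x y m)
  case 0
  show ?case
  proof (cases m)
    case 0
    then show ?thesis using "0.prems" by (simp add: l1_norm_on_zero)
  next
    case (Suc k)
    have "N (\<lambda>w. D 0 x w - D 0 y w) = N (\<lambda>w. D 0 x w + (- 1) * D 0 y w)" by simp
    also have "\<dots> \<le> N (D 0 x) + N (\<lambda>w. (- 1) * D 0 y w)"
      by (rule l1_norm_on_add[OF finite_support_descend finite_support_cmult[OF finite_support_descend]])
    also have "N (\<lambda>w. (- 1) * D 0 y w) = N (D 0 y)"
      unfolding l1_norm_on_def by simp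
    finally show ?thesis using norm_descend[of x 0] norm_descend[of y 0] "0.prems" Suc by simp
  qed
next
  case (Suc j)
  show ?case
  proof (cases m)
    case 0
    then show ?thesis using "Suc.prems" by (simp add: l1_norm_on_zero)
  next
    case (Suc k)
    then obtain c d where cd: "c \<in> {a x, b x}" "d \<in> {a y, b y}" "(level_step ^^ k) c d"
      using level_path_down Suc.prems(1) by blast
    \<comment> \<open>The complementary branch; it coincides with \<open>c\<close> when there is
      only one lower neighbour.\<close>
    define c' where "c' = (if c = a x then b x else a x)"
    define d' where "d' = (if d = a y then b y else a y)"
    have c': "c' \<in> {a x, b x}" "\<And>w. D (Suc j) x w = D j c w + D j c' w"
      using cd unfolding c'_def by auto
    have d': "d' \<in> {a y, b y}" "\<And>w. D (Suc j) y w = D j d w + D j d' w"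
      using cd unfolding d'_def by auto
    have V: "c \<in> verts G" "c' \<in> verts G" "d \<in> verts G" "d' \<in> verts G"
      using cd c' d' down Suc.prems by auto
    have "level_step c' c" "level_step d d'"
      using level_step_down cd c' d' Suc.prems by blast+
    then have far: "(level_step ^^ Suc (Suc k)) c' d'"
      using cd(3) relpowp_Suc_I2 relpowp_Suc_I by metis
    have "N (\<lambda>w. D (Suc j) x w - D (Suc j) y w) =
        N (\<lambda>w. (D j c w - D j d w) + (D j c' w - D j d' w))"
      unfolding c' d' by (simp add: algebra_simps)
    also have "\<dots> \<le> N (\<lambda>w. D j c w - D j d w) + N (\<lambda>w. D j c' w - D j d' w)"
      by (intro l1_norm_on_add finite_support_diff finite_support_descend)
    also have "\<dots> \<le> 2 ^ j * coupling_bound j k + 2 ^ j * coupling_bound j (Suc (Suc k))"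
      using Suc.IH[OF cd(3)] Suc.IH[OF far] V by (intro add_mono) auto
    finally show ?thesis using Suc by (simp add: algebra_simps)
  qed
qed

lemma norm_descend_level:
  assumes "level_step x y"
  shows "N (\<lambda>w. D j x w - D j y w) \<le> 2 ^ j * coupling_bound j 1"
  using norm_descend_diff[of 1 x y j] assms unfolding level_step_def by auto

text \<open>After one step from \<open>v\<close> both branches are within one
  \<open>level_step\<close> of \<open>w\<close>. The factor 2 equalises the masses at the shifted
  times.\<close>

lemma norm_descend_vertical:
  assumes "v \<in> verts G" "w \<in> {a v, b v}"
  shows "N (\<lambda>u. D (Suc j) v u - 2 * D j w u) \<le> 2 ^ Suc j * coupling_bound j 1"
proof -
  have "N (\<lambda>u. D (Suc j) v u - 2 * D j w u) =
      N (\<lambda>u. (D j (a v) u - D j w u) + (D j (b v) u - D j w u))"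
    by (simp add: algebra_simps)
  also have "\<dots> \<le> N (\<lambda>u. D j (a v) u - D j w u) + N (\<lambda>u. D j (b v) u - D j w u)"
    by (intro l1_norm_on_add finite_support_diff finite_support_descend)
  also have "\<dots> \<le> 2 ^ j * coupling_bound j 1 + 2 ^ j * coupling_bound j 1"
    using level_step_down assms by (intro add_mono norm_descend_level) auto
  finally show ?thesis by (simp only: power_Suc mult_2 distrib_right)
qed

section \<open>Time averages with integral values\<close>

text \<open>The factor \<open>2 ^ (n - j)\<close> gives every time \<open>j\<close> the same mass
  \<open>2 ^ n\<close>, so this is \<open>Suc n * 2 ^ n\<close> times the average law over the times
  0 to \<open>n\<close>.\<close>

definition weight :: "nat \<Rightarrow> 'a \<Rightarrow> 'a \<Rightarrow> nat" where
  "weight n v w = (\<Sum>j\<le>n. 2 ^ (n - j) * descend j v w)"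

lemma real_weight: "real (weight n v w) = (\<Sum>j\<le>n. 2 ^ (n - j) * D j v w)"
  unfolding weight_def by simp

lemma finite_support_weight: "finite_support (\<lambda>w. real (weight n v w))"
  unfolding real_weight
  by (intro finite_support_sum finite_support_cmult finite_support_descend) simp

lemma norm_weight:
  assumes "v \<in> verts G"
  shows "N (\<lambda>w. real (weight n v w)) = real (Suc n) * 2 ^ n"
proof -
  have "N (\<lambda>w. real (weight n v w)) = (\<Sum>j\<le>n. N (\<lambda>w. 2 ^ (n - j) * D j v w))"
    unfolding real_weight
    by (intro l1_norm_on_sum_nonneg finite_support_cmult finite_support_descend) auto
  also have "\<dots> = (\<Sum>j\<le>n. 2 ^ n)"
    by (intro sum.cong refl) (simp add: l1_norm_on_cmult norm_descend assms flip: power_add)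
  finally show ?thesis by simp
qed

lemma norm_weight_level:
  assumes "level_step v w"
  shows "N (\<lambda>u. real (weight n v u) - real (weight n w u)) \<le> 2 ^ n * (\<Sum>j\<le>n. coupling_bound j 1)"
proof -
  have "N (\<lambda>u. real (weight n v u) - real (weight n w u)) =
      N (\<lambda>u. \<Sum>j\<le>n. 2 ^ (n - j) * (D j v u - D j w u))"
    unfolding real_weight by (simp add: right_diff_distrib sum_subtractf)
  also have "\<dots> \<le> (\<Sum>j\<le>n. N (\<lambda>u. 2 ^ (n - j) * (D j v u - D j w u)))"
    by (intro l1_norm_on_sum finite_support_cmult finite_support_diff finite_support_descend) auto
  also have "\<dots> \<le> (\<Sum>j\<le>n. 2 ^ n * coupling_bound j 1)"
  proof (rule sum_mono)
    fix j assume j: "j \<in> {..n}"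
    have "N (\<lambda>u. 2 ^ (n - j) * (D j v u - D j w u)) = 2 ^ (n - j) * N (\<lambda>u. D j v u - D j w u)"
      by (rule l1_norm_on_cmult) simp
    also have "\<dots> \<le> 2 ^ (n - j) * (2 ^ j * coupling_bound j 1)"
      using norm_descend_level[OF assms] by (intro mult_left_mono) auto
    also have "\<dots> = 2 ^ n * coupling_bound j 1"
      using j by (simp flip: power_add mult.assoc)
    finally show "N (\<lambda>u. 2 ^ (n - j) * (D j v u - D j w u)) \<le> 2 ^ n * coupling_bound j 1" .
  qed
  finally show ?thesis by (simp add: sum_distrib_left)
qed

text \<open>Shifting the index by one matches \<open>D (Suc j) v\<close> with \<open>2 * D j w\<close>; only the first term of one
  sum and the last term of the other stay unmatched.\<close>

lemma norm_weight_vertical: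
  assumes v: "v \<in> verts G" and w: "w \<in> {a v, b v}"
  shows "N (\<lambda>u. real (weight n v u) - real (weight n w u)) \<le>
    2 ^ n * (2 + (\<Sum>j\<le>n. coupling_bound j 1))"
proof -
  let ?E = "\<lambda>j u. 2 ^ (n - Suc j) * (D (Suc j) v u - 2 * D j w u)"
  have W: "w \<in> verts G" using down v w by auto
  have "real (weight n v u) - real (weight n w u) =
      (2 ^ n * D 0 v u + (\<Sum>j<n. ?E j u)) + (- 1) * D n w u" for u
  proof -
    have "real (weight n v u) = 2 ^ n * D 0 v u + (\<Sum>j<n. 2 ^ (n - Suc j) * D (Suc j) v u)"
      unfolding real_weight by (simp add: sum.atMost_shift del: descend.simps)
    moreover have "real (weight n w u) = (\<Sum>j<n. 2 ^ (n - j) * D j w u) + D n w u"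
      unfolding real_weight by (simp flip: lessThan_Suc_atMost)
    moreover have "(\<Sum>j<n. 2 ^ (n - j) * D j w u) = (\<Sum>j<n. 2 ^ (n - Suc j) * (2 * D j w u))"
    proof (rule sum.cong)
      fix j assume "j \<in> {..<n}"
      then have "n - j = Suc (n - Suc j)" by auto
      then have "(2::real) ^ (n - j) = 2 * 2 ^ (n - Suc j)" by (metis power_Suc)
      then show "2 ^ (n - j) * D j w u = 2 ^ (n - Suc j) * (2 * D j w u)" by simp
    qed simp
    ultimately show ?thesis
      by (simp add: right_diff_distrib sum_subtractf del: descend.simps)
  qed
  then have "N (\<lambda>u. real (weight n v u) - real (weight n w u)) =
      N (\<lambda>u. (2 ^ n * D 0 v u + (\<Sum>j<n. ?E j u)) + (- 1) * D n w u)" by presburger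
  also have fsE: "finite_support (?E j)" for j
    by (intro finite_support_cmult finite_support_diff finite_support_descend)
  have "N (\<lambda>u. (2 ^ n * D 0 v u + (\<Sum>j<n. ?E j u)) + (- 1) * D n w u) \<le>
      N (\<lambda>u. 2 ^ n * D 0 v u + (\<Sum>j<n. ?E j u)) + N (\<lambda>u. (- 1) * D n w u)"
    by (intro l1_norm_on_add finite_support_add finite_support_sum fsE finite_support_cmult
        finite_support_descend) simp
  also have "\<dots> \<le> N (\<lambda>u. 2 ^ n * D 0 v u) + N (\<lambda>u. \<Sum>j<n. ?E j u) + N (\<lambda>u. (- 1) * D n w u)"
    by (intro add_right_mono l1_norm_on_add finite_support_sum fsE finite_support_cmult
        finite_support_descend) simp
  also have "N (\<lambda>u. 2 ^ n * D 0 v u) = 2 ^ n"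
    using norm_descend[OF v, of 0] by (subst l1_norm_on_cmult) simp_all
  also have "N (\<lambda>u. (- 1) * D n w u) = 2 ^ n"
    using norm_descend[OF W, of n] unfolding l1_norm_on_def by simp
  also have "N (\<lambda>u. \<Sum>j<n. ?E j u) \<le> (\<Sum>j<n. N (?E j))"
    by (intro l1_norm_on_sum fsE) simp
  also have "(\<Sum>j<n. N (?E j)) \<le> (\<Sum>j<n. 2 ^ n * coupling_bound j 1)"
  proof (rule sum_mono)
    fix j assume j: "j \<in> {..<n}"
    have "N (?E j) = 2 ^ (n - Suc j) * N (\<lambda>u. D (Suc j) v u - 2 * D j w u)"
      by (rule l1_norm_on_cmult) simp
    also have "\<dots> \<le> 2 ^ (n - Suc j) * (2 ^ Suc j * coupling_bound j 1)"
      using norm_descend_vertical[OF v w] by (intro mult_left_mono) auto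
    also have "\<dots> = 2 ^ n * coupling_bound j 1"
      using j by (simp flip: power_add mult.assoc power_Suc)
    finally show "N (?E j) \<le> 2 ^ n * coupling_bound j 1" .
  qed
  also have "(\<Sum>j<n. 2 ^ n * coupling_bound j 1) \<le> 2 ^ n * (\<Sum>j\<le>n. coupling_bound j 1)"
    unfolding sum_distrib_left using coupling_bound_range by (intro sum_mono2) auto
  finally show ?thesis by (simp add: algebra_simps)
qed

lemma descend_walk:
  "v \<in> verts G \<Longrightarrow> descend j v w \<noteq> 0 \<Longrightarrow>
    \<exists>p. walk G p \<and> hd p = v \<and> last p = w \<and> length p \<le> Suc j"
proof (induction j arbitrary: v)
  case 0
  then have "walk G [v]" "w = v" by (auto simp: walk_def split: if_splits)
  then show ?case by (intro exI[of _ "[v]"]) auto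
next
  case (Suc j)
  then obtain c where c: "c \<in> {a v, b v}" "descend j c w \<noteq> 0" by auto
  then have cV: "c \<in> verts G" and ce: "c = v \<or> {v, c} \<in> edges G"
    using down down_edge Suc.prems by blast+
  obtain p where p: "walk G p" "hd p = c" "last p = w" "length p \<le> Suc j"
    using Suc.IH[OF cV c(2)] by blast
  show ?case
  proof (cases "c = v")
    case True
    then show ?thesis using p by (intro exI[of _ p]) auto
  next
    case False
    have ne: "p \<noteq> []" using p walk_def by blast
    have "walk G (v # p)"
      unfolding walk_def
    proof (intro conjI allI impI)
      fix i assume "Suc i < length (v # p)"
      then show "{(v # p) ! i, (v # p) ! Suc i} \<in> edges G"
        using p ce False ne by (cases i) (auto simp: walk_def hd_conv_nth)
    qed (use p Suc.prems in \<open>auto simp: walk_def\<close>)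
    then show ?thesis using p ne by (intro exI[of _ "v # p"]) auto
  qed
qed

theorem property_A: "property_A G"
  unfolding property_A_def
proof (intro exI conjI allI ballI impI)
  fix n v assume v: "v \<in> verts G"
  show "(\<lambda>w. \<bar>real (weight n v w)\<bar>) summable_on verts G"
    by (rule finite_support_summable[OF finite_support_weight])
  show "0 < N (\<lambda>w. real (weight n v w))" by (simp add: norm_weight v)
  fix w assume "weight n v w \<noteq> 0"
  then obtain j where "j \<in> {..n}" "2 ^ (n - j) * descend j v w \<noteq> 0"
    unfolding weight_def by (rule sum.not_neutral_contains_not_neutral)
  then have j: "j \<le> n" "descend j v w \<noteq> 0" by auto
  then obtain p where p: "walk G p" "hd p = v" "last p = w" "length p \<le> Suc j"
    using descend_walk v by blast
  have "graph_dist G v w \<le> enat (length p - 1)"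
    unfolding graph_dist_def by (rule INF_lower) (use p in simp)
  also have "\<dots> \<le> enat n" using p j by simp
  \<comment> \<open>This fixes \<open>id\<close> as the witness for the radii.\<close>
  finally show "graph_dist G v w \<le> enat (id n)" by simp
next
  \<comment> \<open>The 2 is the cost of the time shift along a vertical edge; the rest is the
    Cesaro mean of the coupling errors at distance 1.\<close>
  define B where "B n = (2 + (\<Sum>j\<le>n. coupling_bound j 1)) / real (Suc n)" for n
  have "(\<lambda>n. 2 / real (Suc n) + (\<Sum>j\<le>n. coupling_bound j 1) / real (Suc n)) \<longlonglongrightarrow> 0 + 0"
    by (intro tendsto_add cesaro_tendsto_0 coupling_bound_tendsto_0)
      (rule LIMSEQ_Suc[OF lim_const_over_n])
  then have B: "B \<longlonglongrightarrow> 0" unfolding B_def by (simp add: add_divide_distrib)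
  have bound: "N (\<lambda>u. real (weight n v u) - real (weight n w u)) / N (\<lambda>u. real (weight n v u)) \<le> B n"
    if e: "{v, w} \<in> edges G" for v w n
  proof -
    have V: "v \<in> verts G" "w \<in> verts G" using edge_verts e by auto
    have "N (\<lambda>u. real (weight n v u) - real (weight n w u)) \<le>
        2 ^ n * (2 + (\<Sum>j\<le>n. coupling_bound j 1))"
    proof (cases "lev v = lev w")
      case True
      then have "level_step v w" using e V by (simp add: level_step_def)
      from norm_weight_level[OF this, of n] show ?thesis
        by (rule order_trans) simp
    next
      case False
      with vertical[OF e] consider "w \<in> {a v, b v}" | "v \<in> {a w, b w}" by blast
      then show ?thesis
      proof cases
        case 1 then show ?thesis by (rule norm_weight_vertical[OF V(1)])
      next
        case 2
        then show ?thesis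
          by (subst l1_norm_on_uminus_diff) (rule norm_weight_vertical[OF V(2)])
      qed
    qed
    then show ?thesis
      unfolding norm_weight[OF V(1)] B_def by (simp add: divide_simps mult.commute)
  qed
  show "uniform_limit {(v, v'). {v, v'} \<in> edges G}
     (\<lambda>n (v, v'). N (\<lambda>w. real (weight n v w) - real (weight n v' w)) / N (\<lambda>w. real (weight n v w)))
     (\<lambda>_. 0) sequentially"
  proof (rule uniform_limitI)
    fix e :: real assume "0 < e"
    then have "\<forall>\<^sub>F n in sequentially. B n < e" using B by (rule order_tendstoD(2)[rotated])
    then show "\<forall>\<^sub>F n in sequentially. \<forall>x\<in>{(v, v'). {v, v'} \<in> edges G}.
        dist (case x of (v, v') \<Rightarrow> N (\<lambda>w. real (weight n v w) - real (weight n v' w)) / N (\<lambda>w. real (weight n v w))) 0 < e"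
    proof (rule eventually_mono)
      fix n assume n: "B n < e"
      have "\<bar>N (\<lambda>w. real (weight n v w) - real (weight n v' w)) / N (\<lambda>w. real (weight n v w))\<bar> < e"
        if "{v, v'} \<in> edges G" for v v'
        using bound[OF that, of n] n by (simp add: l1_norm_on_nonneg)
      then show "\<forall>x\<in>{(v, v'). {v, v'} \<in> edges G}.
        dist (case x of (v, v') \<Rightarrow> N (\<lambda>w. real (weight n v w) - real (weight n v' w)) / N (\<lambda>w. real (weight n v w))) 0 < e"
        by auto
    qed
  qed
qed

end

section \<open>Systolic complexes\<close>

locale systolic_development = wide_links +
  assumes simply_connected: "simply_connected_top (realisation Y)"
begin

abbreviation U :: "'a dev set" where
  "U \<equiv> \<Union>(range level)"

sublocale transport Y U lab step
proof
  show "abstract_complex Y" by (rule complex)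
  show "step s (lab s) = s" for s by (simp add: step_def)
  show "step s x \<in> U" "lab (step s x) = x" if "s \<in> U" "{lab s, x} \<in> Y" for s x
    using step_level that by blast+
  show "step (step s x) y = step s y" if "s \<in> U" "{lab s, x, y} \<in> Y" for s x y
    using step_triangle that .
qed

section \<open>The development is isomorphic to the complex\<close>

definition pred :: "'a dev \<Rightarrow> 'a dev" where
  "pred s = (if parents s = {||} then s else (SOME p. p |\<in>| parents s))"

lemma pred_parent: "parents s \<noteq> {||} \<Longrightarrow> pred s |\<in>| parents s"
  unfolding pred_def by (auto simp flip: ex_fin_conv intro: someI)

lemma lab_in_complex:
  assumes "s \<in> U"
  shows "{lab s} \<in> Y"
proof -
  obtain n where n: "s \<in> level n" using assms by blast
  show ?thesis
  proof (cases n)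
    case 0 then show ?thesis using n base by simp
  next
    case (Suc k)
    then obtain p where "p |\<in>| parents s" using level_Suc_parent n by blast
    then have "{lab p, lab s} \<in> Y" using parent_edge n Suc by blast
    then show ?thesis by (rule face) auto
  qed
qed

lemma pred_step:
  assumes s: "s \<in> U"
  shows "pred s \<in> U" "{lab s, lab (pred s)} \<in> Y"
    "step s (lab (pred s)) = pred s" "step (pred s) (lab s) = s"
proof -
  have "pred s \<in> U \<and> {lab s, lab (pred s)} \<in> Y \<and>
    step s (lab (pred s)) = pred s \<and> step (pred s) (lab s) = s"
  proof (cases "parents s = {||}")
    case True
    then show ?thesis using s lab_in_complex[OF s] step_lab by (simp add: pred_def)
  next
    case False
    then have "dev_adj s (pred s)" using pred_parent s unfolding dev_adj_def by blast
    then show ?thesis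
      using dev_adj_level dev_adj_edge(1) step_eqI dev_adj_sym by blast
  qed
  then show "pred s \<in> U" "{lab s, lab (pred s)} \<in> Y"
    "step s (lab (pred s)) = pred s" "step (pred s) (lab s) = s" by auto
qed

lemma pred_funpow_in: "s \<in> U \<Longrightarrow> (pred ^^ k) s \<in> U"
  by (induction k) (use pred_step(1) in auto)

lemma pred_funpow_level: "s \<in> level (m + k) \<Longrightarrow> (pred ^^ k) s \<in> level m"
proof (induction k arbitrary: m)
  case (Suc k)
  then have "(pred ^^ k) s \<in> level (Suc m)" by (simp del: level.simps)
  then have "pred ((pred ^^ k) s) \<in> level m"
    using level_SucD(1) pred_parent level_Suc_parent by blast
  then show ?case by simp
qed simp

text \<open>Descend from both vertices to the root and concatenate; the resulting closed walk lifts to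
  a closed walk, which passes through both vertices.\<close>

lemma lab_inj_on: "inj_on lab U"
proof (rule inj_onI)
  fix s s' assume s: "s \<in> U" and s': "s' \<in> U" and eq: "lab s = lab s'"
  obtain n n' where n: "s \<in> level n" "s' \<in> level n'" using s s' by blast
  define r where "r = Dev o\<^sub>Y {||}"
  have r: "(pred ^^ n) s = r" "(pred ^^ n') s' = r"
    using pred_funpow_level[of s 0 n] pred_funpow_level[of s' 0 n'] n by (auto simp: r_def)
  define z where "z k = (if k \<le> n then lab ((pred ^^ (n - k)) s) else lab ((pred ^^ (k - n)) s'))" for k
  have z2: "z (n + k) = lab ((pred ^^ k) s')" for k
    by (cases k) (auto simp: z_def eq)
  have edge: "{z k, z (Suc k)} \<in> Y" for k
  proof (cases "k < n")
    case True
    then have "n - k = Suc (n - Suc k)" by simp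
    then show ?thesis using True pred_step(2)[OF pred_funpow_in[OF s], of "n - Suc k"]
      by (simp add: z_def insert_commute)
  next
    case False
    then obtain j where "k = n + j" using le_Suc_ex[of n k] by auto
    then show ?thesis
      using z2[of j] z2[of "Suc j"] pred_step(2)[OF pred_funpow_in[OF s'], of j] by simp
  qed
  have rU: "r \<in> U" unfolding r_def by (rule UN_I[of 0]) auto
  have z0: "lab r = z 0" using r by (simp add: z_def)
  have zl: "z (n + n') = z 0" using z2[of n'] r z0 by simp
  have up: "lift r z k = (pred ^^ (n - k)) s" if "k \<le> n" for k
    using that
  proof (induction k)
    case 0 then show ?case using r by simp
  next
    case (Suc k)
    then have "n - k = Suc (n - Suc k)" by simp
    then show ?case
      using Suc pred_step(4)[OF pred_funpow_in[OF s], of "n - Suc k"] by (simp add: z_def)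
  qed
  have "lift r z (n + n') = r"
    by (rule closed_walk_lift[OF simply_connected rU z0 edge zl])
  have L: "lift r z k \<in> U" "lab (lift r z k) = z k" for k
    using lift_in[OF rU z0 edge, of k k] by auto
  \<comment> \<open>Since the lift is known to end at \<open>r\<close>, its second half can be read
    backwards from there: an edge traversed back and forth lifts to the same vertex.\<close>
  have down: "k \<le> n' \<Longrightarrow> lift r z (n + (n' - k)) = (pred ^^ (n' - k)) s'" for k
  proof (induction k)
    case 0 then show ?case using \<open>lift r z (n + n') = r\<close> r by simp
  next
    case (Suc k)
    define j where "j = n' - Suc k"
    have j: "n' - k = Suc j" using Suc.prems by (simp add: j_def)
    have IH: "lift r z (n + Suc j) = (pred ^^ Suc j) s'" using Suc j by simp
    have "lift r z (n + j) = step (step (lift r z (n + j)) (z (n + Suc j))) (z (n + j))"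
    proof -
      have "{lab (lift r z (n + j)), z (n + Suc j), z (n + j)} \<in> Y"
        using edge[of "n + j"] L(2)[of "n + j"] by (simp add: insert_commute)
      then have "step (step (lift r z (n + j)) (z (n + Suc j))) (z (n + j)) =
          step (lift r z (n + j)) (z (n + j))"
        using step_step[OF L(1)] by blast
      then show ?thesis using step_lab[OF L(1), of "n + j"] L(2)[of "n + j"] by simp
    qed
    also have "\<dots> = step (pred ((pred ^^ j) s')) (lab ((pred ^^ j) s'))"
      using IH z2[of j] by simp
    also have "\<dots> = (pred ^^ j) s'" by (rule pred_step(4)[OF pred_funpow_in[OF s']])
    finally show ?case by (simp add: j_def)
  qed
  show "s = s'" using up[of n] down[of n'] by simp
qed

text \<open>Edges starting in the image lift by \<open>step\<close>, so the image is closed under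
  adjacency and connectedness finishes.\<close>

lemma lab_image: "lab ` U = \<Union>Y"
proof (rule connected_realisation_vertices[OF complex])
  show "connected_space (realisation Y)"
    using simply_connected path_connected_imp_connected_space
    unfolding simply_connected_top_def by blast
  have "Dev o\<^sub>Y {||} \<in> U" by (rule UN_I[of 0]) auto
  then show "lab ` U \<noteq> {}" by blast
  show "lab ` U \<subseteq> \<Union>Y" using lab_in_complex by blast
  show "w \<in> lab ` U" if v: "v \<in> lab ` U" and vw: "{v, w} \<in> Y" for v w
  proof -
    obtain s where s: "v = lab s" "s \<in> U" using v by (rule imageE)
    then have "step s w \<in> U" "lab (step s w) = w" using step_level vw by auto
    then show ?thesis by (metis image_eqI)
  qed
qed

section \<open>Transfer of levels and parents to the complex\<close>

definition sec :: "'a \<Rightarrow> 'a dev" where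
  "sec = the_inv_into U lab"

lemma sec_lab: "s \<in> U \<Longrightarrow> sec (lab s) = s"
  unfolding sec_def by (rule the_inv_into_f_f[OF lab_inj_on])

lemma sec_in: "v \<in> \<Union>Y \<Longrightarrow> sec v \<in> U \<and> lab (sec v) = v"
  using lab_image sec_lab by (metis imageE)

definition lev :: "'a \<Rightarrow> nat" where
  "lev v = (THE n. sec v \<in> level n)"

lemma lev_lab:
  assumes s: "s \<in> level n"
  shows "lev (lab s) = n"
proof -
  have "sec (lab s) = s" using s by (intro sec_lab) blast
  then show ?thesis
    unfolding lev_def using s level_unique by (metis the_equality)
qed

text \<open>A second parent is a coparent of the first, hence unique. With a single parent,
  \<open>p\<close> and \<open>q\<close> coincide, and at the root both are \<open>s\<close>, as
  \<open>descent\<close> expects.\<close>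

lemma two_parents:
  assumes "s \<in> U"
  shows "\<exists>p q. if parents s = {||} then p = s \<and> q = s else fset (parents s) = {p, q}"
proof (cases "parents s = {||}")
  case False
  then obtain p where p: "p |\<in>| parents s" by blast
  obtain n where "s \<in> level n" using assms by blast
  then obtain k where s: "s \<in> level (Suc k)" using parent_level p by blast
  note L = level_SucD[OF s p]
  show ?thesis
  proof (cases "coparents (level k) p (lab s) = {}")
    case True
    then show ?thesis using False L(3) by (intro exI[of _ p]) simp
  next
    case nonempty: False
    then obtain q where q: "q \<in> coparents (level k) p (lab s)" by blast
    then have "coparents (level k) p (lab s) = {q}"
      using coparents_unique[OF L(1,2)] by blast
    then show ?thesis using False L(3) by (intro exI[of _ p] exI[of _ q]) simp
  qed
qed simp

text \<open>The lift of the edge from \<open>sec v\<close> ends over \<open>w\<close>, and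
  \<open>sec w\<close> is the only vertex there.\<close>

lemma edge_dev_adj:
  assumes "{v, w} \<in> Y" "v \<noteq> w"
  shows "dev_adj (sec v) (sec w)"
proof -
  have v: "sec v \<in> U" "lab (sec v) = v" using sec_in assms(1) by blast+
  have "dev_adj (sec v) (step (sec v) w)" "lab (step (sec v) w) = w"
    using step_adj[OF v(1), of w] v(2) assms by auto
  then show ?thesis using sec_lab dev_adj_level by metis
qed

text \<open>The assumptions of \<open>descent\<close> are read off the development:
  \<open>horizontal\<close> from the common parent in \<open>adj\<close>, \<open>down_pair\<close>
  from the adjacency of distinct parents, \<open>vertical\<close> from the three types of
  neighbours.\<close>

lemma property_A_one_skeleton: "property_A (one_skeleton Y)"
proof -
  obtain A B where AB: "\<And>s. s \<in> U \<Longrightarrow>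
      if parents s = {||} then A s = s \<and> B s = s else fset (parents s) = {A s, B s}"
    using two_parents by metis
  have edge_iff: "{v, w} \<in> edges (one_skeleton Y) \<longleftrightarrow> {v, w} \<in> Y \<and> v \<noteq> w" for v w
    by (auto simp: one_skeleton_def)
  have verts: "verts (one_skeleton Y) = \<Union>Y" by (simp add: one_skeleton_def)
  have parent_AB: "p \<in> {A s, B s}" if "s \<in> U" "p |\<in>| parents s" for s p
    using AB[OF that(1)] that(2) by (auto split: if_splits)
  have AB_parent: "A s |\<in>| parents s \<and> B s |\<in>| parents s" if "s \<in> U" "parents s \<noteq> {||}" for s
    using AB[OF that(1)] that(2) by auto
  have AB_in: "A s \<in> U \<and> B s \<in> U" if "s \<in> U" for s
    using that AB[OF that] AB_parent[OF that] parent_level by (metis UN_E UN_I UNIV_I)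
  let ?a = "\<lambda>v. lab (A (sec v))" and ?b = "\<lambda>v. lab (B (sec v))"
  interpret descent "one_skeleton Y" lev ?a ?b
  proof
    show "simple_graph (one_skeleton Y)" by (rule simple_graph_one_skeleton)
  next
    fix v assume "v \<in> verts (one_skeleton Y)"
    then have "v \<in> \<Union>Y" unfolding verts .
    then have v: "sec v \<in> U" "lab (sec v) = v" using sec_in[of v] by simp_all
    show "?a v \<in> verts (one_skeleton Y) \<and> ?b v \<in> verts (one_skeleton Y)"
      using AB_in[OF v(1)] lab_image verts by blast
    have *: "lab p = v \<or> {v, lab p} \<in> edges (one_skeleton Y)" if "p \<in> {A (sec v), B (sec v)}" for p
    proof (cases "parents (sec v) = {||}")
      case True
      then show ?thesis using AB[OF v(1)] that v by auto
    next
      case False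
      then have "p |\<in>| parents (sec v)" using AB_parent v that by blast
      then have "dev_adj (sec v) p" using v unfolding dev_adj_def by blast
      then show ?thesis using dev_adj_edge v edge_iff by metis
    qed
    then show "(?a v = v \<or> {v, ?a v} \<in> edges (one_skeleton Y)) \<and>
        (?b v = v \<or> {v, ?b v} \<in> edges (one_skeleton Y))" by blast
    assume ne: "?a v \<noteq> ?b v"
    then have "parents (sec v) \<noteq> {||}" using AB[OF v(1)] by auto
    then have P: "A (sec v) |\<in>| parents (sec v)" "B (sec v) |\<in>| parents (sec v)"
      using AB_parent v by blast+
    obtain n where "sec v \<in> level n" using v by blast
    then obtain k where k: "sec v \<in> level (Suc k)" using parent_level P by blast
    have "lk (lab (sec v)) (?a v) (?b v)" using parents_adj(2) k P ne by metis
    then have "{?a v, ?b v} \<in> Y" using lk_rot lk_sym lk_edge by metis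
    moreover have "lev (?a v) = k" "lev (?b v) = k" using lev_lab level_SucD(1) k P by blast+
    ultimately show "{?a v, ?b v} \<in> edges (one_skeleton Y) \<and> lev (?a v) = lev (?b v)"
      using ne edge_iff by auto
  next
    fix v w assume e: "{v, w} \<in> edges (one_skeleton Y)"
    then have vw: "v \<in> \<Union>Y" "w \<in> \<Union>Y" "dev_adj (sec v) (sec w)"
      using edge_dev_adj[of v w] unfolding edge_iff by auto
    note v = sec_in[OF vw(1)] and w = sec_in[OF vw(2)]
    obtain n where n: "sec v \<in> level n" using v by blast
    {
      assume "lev v = lev w"
      then have "sec w \<in> level n" using lev_lab n v w by (metis UN_E)
      from vw(3) n have "adj (sec v) (sec w)"
      proof (cases rule: dev_adj_cases)
        case (down k)
        then show ?thesis using level_unique \<open>sec w \<in> level n\<close> by (metis n_not_Suc_n)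
      next
        case up
        then show ?thesis using level_unique \<open>sec w \<in> level n\<close> by (metis n_not_Suc_n)
      qed
      then obtain p where "p |\<in>| parents (sec v)" "p |\<in>| parents (sec w)"
        unfolding adj_def by blast
      then have "p \<in> {A (sec v), B (sec v)}" "p \<in> {A (sec w), B (sec w)}"
        using parent_AB v w by blast+
      then show "{?a v, ?b v} \<inter> {?a w, ?b w} \<noteq> {}" by auto
    next
      assume ne: "lev v \<noteq> lev w"
      from vw(3) n show "v \<in> {?a w, ?b w} \<or> w \<in> {?a v, ?b v}"
      proof (cases rule: dev_adj_cases)
        case same
        then show ?thesis using ne n lev_lab v w by metis
      next
        case (down k)
        then have "sec w \<in> {A (sec v), B (sec v)}" using parent_AB v by blast
        then show ?thesis using w by auto
      next
        case up
        then have "sec v \<in> {A (sec w), B (sec w)}" using parent_AB w by blast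
        then show ?thesis using v by auto
      qed
    }
  qed
  show ?thesis by (rule property_A)
qed

end

theorem mainTheorem1:
  fixes Y :: "'a set set"
  assumes "systolic_2_complex Y"
  shows "property_A (one_skeleton Y)"
proof (cases "\<Union>Y = {}")
  \<comment> \<open>An empty complex offers no base vertex; all conditions of Property A are then
    vacuous.\<close>
  case True
  moreover have "\<forall>\<sigma>\<in>Y. \<sigma> \<noteq> {}"
    using assms unfolding systolic_2_complex_def abstract_complex_def by simp
  ultimately have "Y = {}" by blast
  then show ?thesis
    by (simp add: property_A_def one_skeleton_def uniform_limit_iff)
next
  case False
  then obtain v where v: "v \<in> \<Union>Y" by blast
  have Y: "abstract_complex Y" "simply_connected_top (realisation Y)"
    "\<And>w. w \<in> \<Union>Y \<Longrightarrow> 6 \<le> girth (link_graph Y w)"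
    using assms unfolding systolic_2_complex_def by auto
  obtain \<sigma> where \<sigma>: "\<sigma> \<in> Y" "v \<in> \<sigma>" using v by (rule UnionE)
  have "{v} \<in> Y" by (rule abstract_complex_face[OF Y(1) \<sigma>(1)]) (use \<sigma>(2) in auto)
  then interpret systolic_development Y v
    using Y by unfold_locales auto
  show ?thesis by (rule property_A_one_skeleton)
qed

end
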